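(* Let $\mathbb{K}$ be a field and let $p_i,q_i,\lambda_i,\mu_i\in\mathbb{K}^{\ast}$ for $i=1,2$. Assume that none of $p_1,p_2,q_1,q_2$ is a root of unity. Let $A_1=\mathcal{A}_{p_1}(\lambda_1,\mu_1,\mathbb{K}_{q_1}[s,t])$ and $A_2=\mathcal{A}_{p_2}(\lambda_2,\mu_2,\mathbb{K}_{q_2}[s,t])$. Then $A_1$ is isomorphic to $A_2$ as a $\mathbb{K}$-algebra if and only if one of the following holds: (i) $p_1=p_2,\ q_1=q_2,\ \lambda_1=\lambda_2,\ \mu_1=\mu_2$; (ii) $p_1=p_2^{-1},\ q_1=q_2,\ \lambda_1=\lambda_2^{-1},\ \mu_1=\mu_2^{-1}$; (iii) $p_1=p_2,\ q_1=q_2^{-1},\ \lambda_1=\mu_2,\ \lambda_2=\mu_1$; (iv) $p_1=p_2^{-1},\ q_1=q_2^{-1},\ \lambda_1=\mu_2^{-1},\ \lambda_2=\mu_1^{-1}$.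
   Context: For a field $\mathbb{K}$ and $p,q,\lambda,\mu\in\mathbb{K}^{\ast}$, $\mathcal{A}_p(\lambda,\mu,\mathbb{K}_q[s,t])$ denotes the associative unital $\mathbb{K}$-algebra generated by $x,y,s,t$ subject to the relations $$xy-pyx=1,\quad st=qts,\quad sx=\lambda xs,\quad sy=\lambda^{-1}ys,\quad tx=\mu xt,\quad ty=\mu^{-1}yt.$$ The number $1$ counts as a root of unity. *)

theory Defs
  imports
    "HOL-Library.Poly_Mapping"
    "HOL-Algebra.Module"
    "HOL-Algebra.QuotRing"
begin

text \<open>
  The free monoid on \<open>'g\<close>. A wrapper around lists, written additively only because the convolution
  product of \<open>Poly_Mapping\<close> expects its index monoid in the class \<open>monoid_add\<close>.
\<close>

datatype 'g word = Word (letters: "'g list")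

instantiation word :: (type) monoid_add
begin

definition zero_word :: "'a word" where
  "zero_word = Word []"

definition plus_word :: "'a word \<Rightarrow> 'a word \<Rightarrow> 'a word" where
  "plus_word u v = Word (letters u @ letters v)"

instance
  by standard (auto simp: zero_word_def plus_word_def)

end

text \<open>
  The free associative unital algebra over the field \<open>'k\<close> on \<open>'g\<close> is the monoid algebra of the free
  monoid. A unital associative algebra is represented by the record type of \<open>HOL-Algebra.Module\<close>,
  which carries both the ring operations and the scalar multiplication; the locale \<open>algebra\<close> of that
  theory is not used, since it only covers commutative algebras.
\<close>

type_synonym ('g, 'k) free_alg = "'g word \<Rightarrow>\<^sub>0 'k"

definition free_algebra :: "('k::field, ('g, 'k) free_alg) module" where
  "free_algebra =
     \<lparr>carrier = UNIV, mult = (*), one = 1, zero = 0, add = (+),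
      smult = (\<lambda>c. Poly_Mapping.map ((*) c))\<rparr>"

definition var :: "'g \<Rightarrow> ('g, 'k::field) free_alg" where
  "var g = Poly_Mapping.single (Word [g]) 1"

abbreviation scale :: "'k::field \<Rightarrow> ('g, 'k) free_alg \<Rightarrow> ('g, 'k) free_alg"  (infixr \<open>*\<^sub>F\<close> 75) where
  "scale c f \<equiv> c \<odot>\<^bsub>free_algebra\<^esub> f"

lemma ring_free_algebra: "ring (free_algebra :: ('k::field, ('g, 'k) free_alg) module)"
proof (rule ringI)
  show "abelian_group (free_algebra :: ('k::field, ('g, 'k) free_alg) module)"
    by (rule abelian_groupI)
      (auto simp: free_algebra_def add_ac intro: exI[of _ "- x" for x] left_minus)
  show "Group.monoid (free_algebra :: ('k::field, ('g, 'k) free_alg) module)"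
    by (rule monoidI) (auto simp: free_algebra_def mult.assoc)
qed (auto simp: free_algebra_def algebra_simps)

text \<open>
  Ideals of \<open>HOL-Algebra\<close> are two-sided, and so is the generated ideal \<open>Idl\<close>. The scalar
  multiplication on cosets follows the pattern of \<open>rcoset_mult\<close>, the multiplication of \<open>Quot\<close>.
\<close>

definition quotient_algebra :: "('k, 'a) module \<Rightarrow> 'a set \<Rightarrow> ('k, 'a set) module" where
  "quotient_algebra A I =
     ring.extend (A Quot I)
       (module.fields (\<lambda>c X. \<Union>a\<in>X. I +>\<^bsub>A\<^esub> (c \<odot>\<^bsub>A\<^esub> a)))"

definition presented_algebra ::
    "('g, 'k::field) free_alg set \<Rightarrow> ('k, ('g, 'k) free_alg set) module" where
  "presented_algebra R = quotient_algebra free_algebra (Idl\<^bsub>free_algebra\<^esub> R)"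

text \<open>The relation \<open>a = b\<close> is encoded by the element \<open>a - b\<close> of the free algebra.\<close>

datatype gen = Gen_x | Gen_y | Gen_s | Gen_t

definition quantum_weyl_relations :: "'k::field \<Rightarrow> 'k \<Rightarrow> 'k \<Rightarrow> 'k \<Rightarrow> (gen, 'k) free_alg set" where
  "quantum_weyl_relations p l m q =
     (let x = var Gen_x; y = var Gen_y; s = var Gen_s; t = var Gen_t in
      {x * y - p *\<^sub>F (y * x) - 1,
       s * t - q *\<^sub>F (t * s),
       s * x - l *\<^sub>F (x * s),
       s * y - inverse l *\<^sub>F (y * s),
       t * x - m *\<^sub>F (x * t),
       t * y - inverse m *\<^sub>F (y * t)})"

text \<open>\<open>quantum_weyl_extension p l m q\<close> is \<open>\<A>\<^sub>p(\<lambda>, \<mu>, K\<^sub>q[s, t])\<close> for \<open>\<lambda> = l\<close>, \<open>\<mu> = m\<close>, \<open>K = UNIV :: 'k set\<close>.\<close>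

definition quantum_weyl_extension :: "'k::field \<Rightarrow> 'k \<Rightarrow> 'k \<Rightarrow> 'k \<Rightarrow> ('k, (gen, 'k) free_alg set) module" where
  "quantum_weyl_extension p l m q = presented_algebra (quantum_weyl_relations p l m q)"

definition algebra_isomorphic :: "('k, 'a) module \<Rightarrow> ('k, 'b) module \<Rightarrow> bool" where
  "algebra_isomorphic A B \<longleftrightarrow>
     (\<exists>h \<in> ring_iso A B. \<forall>c. \<forall>a \<in> carrier A. h (c \<odot>\<^bsub>A\<^esub> a) = c \<odot>\<^bsub>B\<^esub> h a)"

definition root_of_unity :: "'k::field \<Rightarrow> bool" where
  "root_of_unity a \<longleftrightarrow> (\<exists>n::nat. n > 0 \<and> a ^ n = 1)"

end

theory Submission
  imports Defs "HOL-Library.Product_Lexorder" "HOL-Library.Product_Plus"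
begin

text \<open>
  Write A for one of the algebras, with parameters \<open>p\<close>, \<open>\<lambda>\<close>, \<open>\<mu>\<close>, \<open>q\<close>. The element \<open>z = 1 + (p - 1) y x\<close>
  satisfies \<open>x z = p z x\<close> and commutes with \<open>s\<close> and \<open>t\<close>, and \<open>y\<close> can be recovered from it as
  \<open>(z - 1) / (p - 1) x\<^sup>-\<^sup>1\<close>. Hence A maps to the quantum torus T with basis \<open>z\<^sup>a x\<^sup>b s\<^sup>c t\<^sup>d\<close>,
  \<open>a, b, c, d \<in> \<int>\<close>, which is the group algebra of \<open>\<int>\<^sup>4\<close> twisted by a bicharacter. The normal words
  \<open>y\<^sup>i x\<^sup>j s\<^sup>c t\<^sup>d\<close> span A, and in the lexicographic order their images have the distinct leading
  exponents \<open>(i, j - i, c, d)\<close>. So A embeds into T (\<open>embed_eq_zero_iff\<close>), and the leading exponent \<open>(a, b, c, d)\<close> of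
  any nonzero element of A satisfies \<open>a, c, d \<ge> 0\<close> and \<open>a + b \<ge> 0\<close> (\<open>Max_keys_embed\<close>).

  An isomorphism preserves normal elements, that is, nonzero \<open>u\<close> with \<open>u A \<subseteq> A u\<close>. If \<open>u\<close> is normal and \<open>g\<close> is one of the
  monomials \<open>z, x, s, t\<close>, then \<open>u g = g' u\<close>; comparing largest and smallest exponents in T, \<open>g'\<close> is a
  multiple of \<open>g\<close>. Since neither \<open>p\<close> nor \<open>q\<close> is a root of unity, the commutation factors with \<open>z, x, s, t\<close>
  determine an exponent, so \<open>u\<close> is a single monomial \<open>k z\<^sup>a x\<^sup>b s\<^sup>c t\<^sup>d\<close>. Conjugating \<open>y\<close> by it
  gives \<open>(p\<^sup>b z - 1) x\<^sup>-\<^sup>1\<close> up to a factor, and if \<open>b \<noteq> 0\<close>, then this element together with \<open>y\<close> would place \<open>x\<^sup>-\<^sup>1\<close>,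
  with leading exponent \<open>(0, -1, 0, 0)\<close>, in A. So the normal elements are exactly the nonzero multiples of the \<open>z\<^sup>a s\<^sup>c t\<^sup>d\<close>
  with \<open>a, c, d \<ge> 0\<close> (\<open>normal_imp_monomial\<close>, \<open>monomial_normal\<close>), and the irreducible ones among them are the multiples of \<open>z, s, t\<close>.

  An isomorphism therefore sends each of \<open>z, s, t\<close> to a multiple of one of \<open>z, s, t\<close> (\<open>map_generator\<close>). As \<open>q \<noteq> 1\<close>, only \<open>s\<close> and
  \<open>t\<close> fail to commute, so \<open>z\<close> is fixed up to a factor, and \<open>s, t\<close> are either kept or interchanged. The
  commutation of the image of \<open>x\<close> with those of \<open>z, s, t\<close>, read off at a leading exponent \<open>(a, b, c, d)\<close>, gives
  \<open>p\<^sub>1 = p\<^sub>2\<^sup>b\<close> and expresses \<open>\<lambda>\<^sub>1, \<mu>\<^sub>1\<close> by \<open>\<lambda>\<^sub>2\<^sup>b, \<mu>\<^sub>2\<^sup>b\<close> up to nonnegative powers of \<open>q\<^sub>2\<close> or of its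
  inverse. The same for the image of \<open>y\<close> yields these powers with the opposite sign, hence they vanish
  (\<open>parameters_determined\<close>). Applying \<open>p\<^sub>1 = p\<^sub>2\<^sup>b\<close> also to the inverse isomorphism leaves \<open>b = 1\<close> or \<open>b = -1\<close>, which are the four cases.
  Conversely, the four cases are realised by exchanging \<open>x\<close> with \<open>y\<close>, up to a factor, and \<open>s\<close> with \<open>t\<close>.
\<close>

section \<open>Finitely supported functions and the free algebra\<close>

text \<open>
  This makes \<open>\<int>\<^sup>4\<close> with the lexicographic order an ordered group, which gives elements of the torus
  leading exponents that add up under multiplication.
\<close>

instance prod :: (linordered_ab_group_add, linordered_ab_group_add) linordered_ab_group_add
proof
  fix a b c :: "'a \<times> 'b"
  assume "a \<le> b"
  then show "c + a \<le> c + b"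
    by (cases a; cases b; cases c) auto
qed

abbreviation lookup :: "('b \<Rightarrow>\<^sub>0 'k::zero) \<Rightarrow> 'b \<Rightarrow> 'k" where
  "lookup \<equiv> Poly_Mapping.lookup"

abbreviation keys :: "('b \<Rightarrow>\<^sub>0 'k::zero) \<Rightarrow> 'b set" where
  "keys \<equiv> Poly_Mapping.keys"

abbreviation single :: "'b \<Rightarrow> 'k::zero \<Rightarrow> 'b \<Rightarrow>\<^sub>0 'k" where
  "single \<equiv> Poly_Mapping.single"

text \<open>
  Scalar multiplication for an arbitrary index set, so that the free algebra and the quantum torus
  share one notation.
\<close>
abbreviation scl :: "'k::field \<Rightarrow> ('b \<Rightarrow>\<^sub>0 'k) \<Rightarrow> ('b \<Rightarrow>\<^sub>0 'k)"  (infixr \<open>*\<^sub>P\<close> 75) where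
  "c *\<^sub>P f \<equiv> Poly_Mapping.map ((*) c) f"

lemma lookup_scl [simp]: "lookup (c *\<^sub>P f) k = c * lookup f k" for c :: "'k::field"
  by (simp add: map.rep_eq when_def)

lemma scl_simps:
  fixes f g :: "'b \<Rightarrow>\<^sub>0 'k::field"
  shows "c *\<^sub>P (f + g) = c *\<^sub>P f + c *\<^sub>P g" "c *\<^sub>P (f - g) = c *\<^sub>P f - c *\<^sub>P g"
    "(c + d) *\<^sub>P f = c *\<^sub>P f + d *\<^sub>P f" "(c - d) *\<^sub>P f = c *\<^sub>P f - d *\<^sub>P f"
    "c *\<^sub>P d *\<^sub>P f = (c * d) *\<^sub>P f" "c *\<^sub>P (- f) = - (c *\<^sub>P f)" "(- c) *\<^sub>P f = - (c *\<^sub>P f)"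
  by (rule poly_mapping_eqI; simp add: lookup_add lookup_minus algebra_simps)+

lemma scl_trivial [simp]:
  fixes f :: "'b \<Rightarrow>\<^sub>0 'k::field"
  shows "1 *\<^sub>P f = f" "0 *\<^sub>P f = 0" "c *\<^sub>P (0 :: 'b \<Rightarrow>\<^sub>0 'k) = 0"
  by (rule poly_mapping_eqI; simp)+

lemma scl_single [simp]: "c *\<^sub>P single a d = single a (c * d)" for c :: "'k::field"
  by (rule poly_mapping_eqI) (simp add: lookup_single when_def)

text \<open>The simplifier turns \<open>(*) 1\<close> into this abstraction.\<close>
lemma map_ident [simp]: "Poly_Mapping.map (\<lambda>c. c) f = f"
  by (rule poly_mapping_eqI) (simp add: map.rep_eq when_def)

lemma single_eq_zero_iff [simp]: "single a c = 0 \<longleftrightarrow> c = 0"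
  by (metis lookup_single_eq lookup_zero single_zero)

lemma scl_sum: "c *\<^sub>P sum f A = (\<Sum>a\<in>A. c *\<^sub>P f a)" for c :: "'k::field"
  by (rule poly_mapping_eqI) (simp add: lookup_sum sum_distrib_left)

lemma scl_cancel: "c \<noteq> 0 \<Longrightarrow> c *\<^sub>P f = c *\<^sub>P g \<Longrightarrow> f = g" for c :: "'k::field"
  by (drule arg_cong[of _ _ "\<lambda>h. inverse c *\<^sub>P h"]) (simp add: scl_simps)

lemma poly_mapping_additive_induct [case_names zero single add]:
  fixes f :: "'b \<Rightarrow>\<^sub>0 'k::comm_monoid_add"
  assumes "P 0" "\<And>a c. P (single a c)" "\<And>f g. P f \<Longrightarrow> P g \<Longrightarrow> P (f + g)"
  shows "P f"
proof -
  have expand: "f = (\<Sum>a\<in>keys f. single a (lookup f a))"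
    by (rule poly_mapping_eqI)
      (simp add: lookup_sum lookup_single when_def in_keys_iff)
  have "P (\<Sum>a\<in>A. single a (lookup f a))" if "finite A" for A
    using that by induction (auto intro: assms)
  then show ?thesis
    by (subst expand) simp
qed

text \<open>The linear extension of a map given on the basis.\<close>
definition lin :: "('a \<Rightarrow> ('b \<Rightarrow>\<^sub>0 'k)) \<Rightarrow> ('a \<Rightarrow>\<^sub>0 'k::field) \<Rightarrow> ('b \<Rightarrow>\<^sub>0 'k)" where
  "lin \<phi> f = (\<Sum>a\<in>keys f. lookup f a *\<^sub>P \<phi> a)"

lemma lin_superset: "finite A \<Longrightarrow> keys f \<subseteq> A \<Longrightarrow> lin \<phi> f = (\<Sum>a\<in>A. lookup f a *\<^sub>P \<phi> a)"
  unfolding lin_def by (rule sum.mono_neutral_left) (auto simp: in_keys_iff)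

lemma lin_zero [simp]: "lin \<phi> 0 = 0"
  by (simp add: lin_def)

lemma lin_single [simp]: "lin \<phi> (single a c) = c *\<^sub>P \<phi> a"
  by (cases "c = 0") (auto simp: lin_def)

lemma lin_add: "lin \<phi> (f + g) = lin \<phi> f + lin \<phi> g"
proof -
  have "keys (f + g) \<subseteq> keys f \<union> keys g"
    by (rule keys_add)
  then show ?thesis
    by (simp add: lin_superset[of "keys f \<union> keys g"] lookup_add scl_simps sum.distrib)
qed

lemma lin_scl: "lin \<phi> (c *\<^sub>P f) = c *\<^sub>P lin \<phi> f"
proof -
  have "keys (c *\<^sub>P f) \<subseteq> keys f"
    by (auto simp: in_keys_iff)
  then show ?thesis
    by (simp add: lin_superset[of "keys f"] scl_sum scl_simps)
qed

lemma lin_fun_add: "lin (\<lambda>a. \<phi> a + \<psi> a) f = lin \<phi> f + lin \<psi> f"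
  by (simp add: lin_def scl_simps sum.distrib)

lemma lin_fun_scl: "lin (\<lambda>a. c *\<^sub>P \<phi> a) f = c *\<^sub>P lin \<phi> f"
  by (simp add: lin_def scl_sum scl_simps mult.commute)

lemma free_algebra_induct [case_names one var scl add mult]:
  fixes f :: "('g, 'k::field) free_alg"
  assumes one: "P 1" and var: "\<And>g. P (var g)" and scl: "\<And>c f. P f \<Longrightarrow> P (c *\<^sub>P f)"
    and add: "\<And>f g. P f \<Longrightarrow> P g \<Longrightarrow> P (f + g)" and mult: "\<And>f g. P f \<Longrightarrow> P g \<Longrightarrow> P (f * g)"
  shows "P f"
proof (induction f rule: poly_mapping_additive_induct)
  case zero
  show ?case
    using scl[OF one, of 0] by simp
next
  case (single w c)
  have "P (single (Word xs) 1)" for xs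
  proof (induction xs)
    case Nil
    show ?case
      using one by (simp flip: zero_word_def)
  next
    case (Cons g xs)
    have "single (Word (g # xs)) 1 = (var g * single (Word xs) 1 :: ('g, 'k) free_alg)"
      by (simp add: var_def mult_single plus_word_def)
    then show ?case
      by (simp add: mult var Cons)
  qed
  then have "P (c *\<^sub>P single w 1)"
    by (metis word.exhaust scl)
  then show ?case
    by simp
qed (rule add)

text \<open>
  An associative unital algebra structure on a space with a distinguished basis. The multiplication is
  a parameter because that of the quantum torus depends on the field elements that define it.
\<close>
locale poly_algebra =
  fixes mul :: "('b \<Rightarrow>\<^sub>0 'k::field) \<Rightarrow> ('b \<Rightarrow>\<^sub>0 'k) \<Rightarrow> ('b \<Rightarrow>\<^sub>0 'k)"  (infixl \<open>\<cdot>\<close> 70)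
    and unit :: "'b \<Rightarrow>\<^sub>0 'k"
  assumes add_mul: "(f + g) \<cdot> h = f \<cdot> h + g \<cdot> h"
    and mul_add: "f \<cdot> (g + h) = f \<cdot> g + f \<cdot> h"
    and scl_mul: "(c *\<^sub>P f) \<cdot> g = c *\<^sub>P (f \<cdot> g)"
    and mul_scl: "f \<cdot> (c *\<^sub>P g) = c *\<^sub>P (f \<cdot> g)"
    and mul_assoc: "f \<cdot> g \<cdot> h = f \<cdot> (g \<cdot> h)"
    and unit_mul [simp]: "unit \<cdot> f = f"
    and mul_unit [simp]: "f \<cdot> unit = f"
begin

lemma zero_mul [simp]: "0 \<cdot> f = 0"
  using scl_mul[of 0 f f] by simp

lemma mul_zero [simp]: "f \<cdot> 0 = 0"
  using mul_scl[of f 0 f] by simp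

lemma minus_mul: "(f - g) \<cdot> h = f \<cdot> h - g \<cdot> h"
  using add_mul[of "f - g" g h] by (simp add: algebra_simps)

lemma mul_minus: "h \<cdot> (f - g) = h \<cdot> f - h \<cdot> g"
  using mul_add[of h "f - g" g] by (simp add: algebra_simps)

text \<open>
  The universal property of the free algebra: \<open>eval v\<close> is the unique algebra homomorphism that sends each
  generator \<open>g\<close> to \<open>v g\<close>.
\<close>
definition eval_word :: "('g \<Rightarrow> 'b \<Rightarrow>\<^sub>0 'k) \<Rightarrow> 'g word \<Rightarrow> 'b \<Rightarrow>\<^sub>0 'k" where
  "eval_word v w = foldr (\<lambda>g a. v g \<cdot> a) (letters w) unit"

definition eval :: "('g \<Rightarrow> 'b \<Rightarrow>\<^sub>0 'k) \<Rightarrow> ('g, 'k) free_alg \<Rightarrow> 'b \<Rightarrow>\<^sub>0 'k" where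
  "eval v = lin (eval_word v)"

lemma eval_word_plus: "eval_word v (u + w) = eval_word v u \<cdot> eval_word v w"
proof -
  have "foldr (\<lambda>g a. v g \<cdot> a) xs b = foldr (\<lambda>g a. v g \<cdot> a) xs unit \<cdot> b" for xs b
    by (induction xs) (simp_all add: mul_assoc)
  from this[of "letters u" "eval_word v w"] show ?thesis
    by (simp add: eval_word_def plus_word_def)
qed

lemma eval_add: "eval v (f + g) = eval v f + eval v g"
  by (simp add: eval_def lin_add)

lemma eval_scl: "eval v (c *\<^sub>P f) = c *\<^sub>P eval v f"
  by (simp add: eval_def lin_scl)

lemma eval_zero [simp]: "eval v 0 = 0"
  by (simp add: eval_def)

lemma eval_uminus: "eval v (- f) = - eval v f"
  using eval_scl[of v "- 1" f] by (simp add: scl_simps)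

lemma eval_minus: "eval v (f - g) = eval v f - eval v g"
  using eval_add[of v f "- g"] by (simp add: eval_uminus)

lemma eval_one [simp]: "eval v 1 = unit"
  unfolding eval_def single_one[symmetric] lin_single
  by (simp add: eval_word_def zero_word_def)

lemma eval_var [simp]: "eval v (var g) = v g"
  by (simp add: eval_def var_def eval_word_def)

lemma eval_mult: "eval v (f * g) = eval v f \<cdot> eval v g"
proof (induction f rule: poly_mapping_additive_induct)
  case (single a c)
  show ?case
  proof (induction g rule: poly_mapping_additive_induct)
    case (single b d)
    show ?case
      by (simp add: eval_def mult_single eval_word_plus scl_mul mul_scl scl_simps mult.commute)
  qed (simp_all add: eval_add ring_distribs mul_add)
qed (simp_all add: eval_add ring_distribs add_mul)

lemmas eval_hom = eval_add eval_scl eval_uminus eval_minus eval_mult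

lemma eval_unique:
  assumes "\<And>f g. h (f + g) = h f + h g" "\<And>c f. h (c *\<^sub>P f) = c *\<^sub>P h f"
    and "\<And>f g. h (f * g) = h f \<cdot> h g" "h 1 = unit" "\<And>g. h (var g) = v g"
  shows "h f = eval v f"
  by (induction f rule: free_algebra_induct) (simp_all add: assms eval_hom)

end

lemma scalar_central: "f * single 0 c = single 0 c * f" for f :: "('g, 'k::field) free_alg"
  by (induction f rule: poly_mapping_additive_induct)
    (simp_all add: ring_distribs mult_single mult.commute)

interpretation free: poly_algebra "(*)" "1 :: ('g, 'k::field) free_alg"
proof
  fix f g :: "('g, 'k) free_alg" and c :: 'k
  show "(c *\<^sub>P f) * g = c *\<^sub>P (f * g)"
    by (simp only: mult_map_scale_conv_mult mult.assoc)
  show "f * (c *\<^sub>P g) = c *\<^sub>P (f * g)"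
    unfolding mult_map_scale_conv_mult by (metis mult.assoc scalar_central)
qed (simp_all only: ring_distribs mult.assoc mult_1_left mult_1_right)

section \<open>Twisted group algebras of ordered groups\<close>

text \<open>
  Vectors with pairwise distinct leading exponents are linearly independent: in a combination, the largest
  of the leading exponents that occur cannot cancel.
\<close>
lemma
  fixes \<phi> :: "'a \<Rightarrow> ('e::linorder \<Rightarrow>\<^sub>0 'k::field)"
  assumes nonzero: "\<And>a. \<phi> a \<noteq> 0" and inj: "inj (\<lambda>a. Max (keys (\<phi> a)))" and "f \<noteq> 0"
  shows lin_nonzero: "lin \<phi> f \<noteq> 0"
    and Max_keys_lin: "\<exists>a\<in>keys f. Max (keys (lin \<phi> f)) = Max (keys (\<phi> a))"
proof -
  let ?L = "\<lambda>a. Max (keys (\<phi> a))"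
  have "keys f \<noteq> {}"
    using \<open>f \<noteq> 0\<close> by simp
  then have "Max (?L ` keys f) \<in> ?L ` keys f"
    by (intro Max_in) auto
  then obtain a where a: "a \<in> keys f" "?L a = Max (?L ` keys f)"
    by force
  have le: "?L b \<le> ?L a" if "b \<in> keys f" for b
    unfolding a(2) using that by simp
  have "lookup (\<phi> b) (?L a) = 0" if "b \<in> keys f" "b \<noteq> a" for b
  proof -
    have "?L b < ?L a"
      using le[OF that(1)] injD[OF inj, of b a] that(2) by fastforce
    then show ?thesis
      by (metis Max_ge finite_keys in_keys_iff leD)
  qed
  then have "lookup (lin \<phi> f) (?L a) = (\<Sum>b\<in>keys f. if b = a then lookup f a * lookup (\<phi> a) (?L a) else 0)"
    unfolding lin_def lookup_sum by (intro sum.cong) auto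
  also have "\<dots> = lookup f a * lookup (\<phi> a) (?L a)"
    using a by simp
  also have "\<dots> \<noteq> 0"
    using a Max_in[of "keys (\<phi> a)"] nonzero[of a] by (auto simp: in_keys_iff)
  finally have in_keys: "?L a \<in> keys (lin \<phi> f)"
    by (simp add: in_keys_iff)
  then show "lin \<phi> f \<noteq> 0"
    by auto
  have "n \<le> ?L a" if "n \<in> keys (lin \<phi> f)" for n
  proof -
    obtain b where "b \<in> keys f" "n \<in> keys (lookup f b *\<^sub>P \<phi> b)"
      using \<open>n \<in> keys (lin \<phi> f)\<close> keys_sum unfolding lin_def by fast
    then have "n \<le> ?L b"
      by (auto simp: in_keys_iff intro: Max_ge)
    then show ?thesis
      using le[OF \<open>b \<in> keys f\<close>] by simp
  qed
  then show "\<exists>a\<in>keys f. Max (keys (lin \<phi> f)) = ?L a"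
    using in_keys a(1) by (intro bexI[of _ a] Max_eqI) auto
qed

text \<open>
  For a bicharacter \<open>\<omega>\<close> the product of basis elements \<open>a\<close> and \<open>b\<close> is \<open>\<omega> a b\<close> times the basis element
  \<open>a + b\<close>; that \<open>\<omega>\<close> is multiplicative in each argument makes this associative.
\<close>
locale twisted_group_algebra =
  fixes \<omega> :: "'e::linordered_ab_group_add \<Rightarrow> 'e \<Rightarrow> 'k::field"
  assumes cocycle_add_left: "\<omega> (a + b) c = \<omega> a c * \<omega> b c"
    and cocycle_add_right: "\<omega> a (b + c) = \<omega> a b * \<omega> a c"
    and cocycle_nonzero [simp]: "\<omega> a b \<noteq> 0"
begin

definition mul :: "('e \<Rightarrow>\<^sub>0 'k) \<Rightarrow> ('e \<Rightarrow>\<^sub>0 'k) \<Rightarrow> ('e \<Rightarrow>\<^sub>0 'k)"  (infixl \<open>\<star>\<close> 70) where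
  "f \<star> g = lin (\<lambda>a. lin (\<lambda>b. single (a + b) (\<omega> a b)) g) f"

lemma cocycle_zero [simp]: "\<omega> 0 a = 1" "\<omega> a 0 = 1"
  using cocycle_add_left[of 0 0 a] cocycle_add_right[of a 0 0] by simp_all

lemma mul_single_single [simp]: "single a c \<star> single b d = single (a + b) (c * d * \<omega> a b)"
  by (simp add: mul_def mult.assoc)

sublocale poly_algebra mul 1
proof
  fix f g h :: "'e \<Rightarrow>\<^sub>0 'k" and c :: 'k
  show l: "(f + g) \<star> h = f \<star> h + g \<star> h" for f g h
    by (simp add: mul_def lin_add)
  show r: "f \<star> (g + h) = f \<star> g + f \<star> h" for f g h
    by (simp add: mul_def lin_add lin_fun_add)
  show "(c *\<^sub>P f) \<star> g = c *\<^sub>P (f \<star> g)"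
    by (simp add: mul_def lin_scl)
  show "f \<star> (c *\<^sub>P g) = c *\<^sub>P (f \<star> g)"
    by (simp add: mul_def lin_scl lin_fun_scl)
  have z: "f \<star> 0 = 0" "0 \<star> f = 0" for f
    by (simp_all add: mul_def) (simp add: lin_def)
  show "1 \<star> f = f" unfolding single_one[symmetric]
    by (induction f rule: poly_mapping_additive_induct) (simp_all add: l r z del: single_one)
  show "f \<star> 1 = f" unfolding single_one[symmetric]
    by (induction f rule: poly_mapping_additive_induct) (simp_all add: l r z del: single_one)
  show "f \<star> g \<star> h = f \<star> (g \<star> h)"
  proof (induction f rule: poly_mapping_additive_induct)
    case (single a c)
    show ?case
    proof (induction g rule: poly_mapping_additive_induct)
      case (single b d)
      show ?case
        by (induction h rule: poly_mapping_additive_induct)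
          (simp_all add: l r z add.assoc cocycle_add_left cocycle_add_right mult_ac)
    qed (simp_all add: l r z)
  qed (simp_all add: l r z)
qed

lemma lookup_mul_single: "lookup (f \<star> single a c) (b + a) = c * \<omega> b a * lookup f b"
proof (induction f rule: poly_mapping_additive_induct)
  case (single b' d)
  then show ?case
    by (cases "b' = b") (auto simp: lookup_single when_def)
qed (simp_all add: add_mul lookup_add algebra_simps)

lemma lookup_single_mul: "lookup (single a c \<star> f) (b + a) = c * \<omega> a b * lookup f b"
proof (induction f rule: poly_mapping_additive_induct)
  case (single b' d)
  then show ?case
    by (cases "b' = b") (auto simp: lookup_single when_def add.commute)
qed (simp_all add: mul_add lookup_add algebra_simps)

lemma lookup_mul:
  "lookup (f \<star> g) n =
     (\<Sum>(a, b) \<in> keys f \<times> keys g. if a + b = n then lookup f a * lookup g b * \<omega> a b else 0)"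
  by (auto simp: mul_def lin_def scl_sum lookup_sum sum.cartesian_product lookup_single when_def
      mult.assoc intro!: sum.cong)

lemma lookup_mul_unique:
  assumes "a \<in> keys f" "b \<in> keys g"
    and unique: "\<And>a' b'. a' \<in> keys f \<Longrightarrow> b' \<in> keys g \<Longrightarrow> a' + b' = a + b \<Longrightarrow> a' = a \<and> b' = b"
  shows "lookup (f \<star> g) (a + b) = lookup f a * lookup g b * \<omega> a b"
proof -
  have "lookup (f \<star> g) (a + b) =
      (\<Sum>k \<in> keys f \<times> keys g. if k = (a, b) then lookup f a * lookup g b * \<omega> a b else 0)"
    unfolding lookup_mul by (rule sum.cong) (use unique in \<open>auto split: if_splits\<close>)
  then show ?thesis
    using assms by (simp add: sum.delta')
qed

lemma keys_mul: "keys (f \<star> g) \<subseteq> {a + b | a b. a \<in> keys f \<and> b \<in> keys g}"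
proof
  fix n assume "n \<in> keys (f \<star> g)"
  then have "lookup (f \<star> g) n \<noteq> 0"
    by (simp add: in_keys_iff)
  then show "n \<in> {a + b | a b. a \<in> keys f \<and> b \<in> keys g}"
    unfolding lookup_mul by (rule contrapos_np) (auto intro!: sum.neutral)
qed

lemma Max_keys_in: "f \<noteq> 0 \<Longrightarrow> Max (keys f) \<in> keys f"
  and Min_keys_in: "f \<noteq> 0 \<Longrightarrow> Min (keys f) \<in> keys f" for f :: "'e \<Rightarrow>\<^sub>0 'k"
  by (metis Max_in Min_in finite_keys poly_mapping_eqI lookup_zero in_keys_iff empty_iff)+

text \<open>
  In an ordered group the sum of the two largest exponents, and that of the two smallest, arises from only one pair,
  so the corresponding coefficient of the product does not cancel.
\<close>
lemma
  assumes "f \<noteq> 0" "g \<noteq> 0"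
  shows mul_nonzero: "f \<star> g \<noteq> 0"
    and Max_keys_mul: "Max (keys (f \<star> g)) = Max (keys f) + Max (keys g)"
    and Min_keys_mul: "Min (keys (f \<star> g)) = Min (keys f) + Min (keys g)"
proof -
  let ?F = "Max (keys f)" and ?G = "Max (keys g)"
  have "lookup (f \<star> g) (?F + ?G) = lookup f ?F * lookup g ?G * \<omega> ?F ?G"
  proof (rule lookup_mul_unique)
    fix a b assume "a \<in> keys f" "b \<in> keys g" and eq: "a + b = ?F + ?G"
    then have "a \<le> ?F" "b \<le> ?G"
      by simp_all
    then show "a = ?F \<and> b = ?G"
      using eq by (metis add_le_less_mono add_less_le_mono less_irrefl order_le_less)
  qed (use assms in \<open>simp_all add: Max_keys_in\<close>)
  then have F: "?F + ?G \<in> keys (f \<star> g)"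
    using assms by (simp add: in_keys_iff Max_keys_in[unfolded in_keys_iff])
  then show "f \<star> g \<noteq> 0"
    by auto
  show "Max (keys (f \<star> g)) = ?F + ?G"
    by (rule Max_eqI) (use F keys_mul[of f g] in \<open>auto intro!: add_mono\<close>)
  let ?F = "Min (keys f)" and ?G = "Min (keys g)"
  have "lookup (f \<star> g) (?F + ?G) = lookup f ?F * lookup g ?G * \<omega> ?F ?G"
  proof (rule lookup_mul_unique)
    fix a b assume "a \<in> keys f" "b \<in> keys g" and eq: "a + b = ?F + ?G"
    then have "a \<ge> ?F" "b \<ge> ?G"
      by simp_all
    then show "a = ?F \<and> b = ?G"
      using eq by (metis add_le_less_mono add_less_le_mono less_irrefl order_le_less)
  qed (use assms in \<open>simp_all add: Min_keys_in\<close>)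
  then have F: "?F + ?G \<in> keys (f \<star> g)"
    using assms by (simp add: in_keys_iff Min_keys_in[unfolded in_keys_iff])
  show "Min (keys (f \<star> g)) = ?F + ?G"
    by (rule Min_eqI) (use F keys_mul[of f g] in \<open>auto intro!: add_mono\<close>)
qed

text \<open>
  The largest and the smallest exponent of \<open>v\<close> must both equal \<open>e\<close>, since those of \<open>u\<close> cancel.
\<close>
lemma conjugate_monomial:
  assumes "u \<noteq> 0" "c \<noteq> 0" and eq: "u \<star> single e c = v \<star> u"
  obtains d where "v = single e d"
proof -
  have "u \<star> single e c \<noteq> 0"
    by (rule mul_nonzero) (use assms in auto)
  then have "v \<noteq> 0"
    unfolding eq by auto
  have "single e c \<noteq> 0"
    using \<open>c \<noteq> 0\<close> by auto
  have "Max (keys v) = e"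
    using arg_cong[OF eq, of "\<lambda>f. Max (keys f)"] Max_keys_mul \<open>u \<noteq> 0\<close> \<open>v \<noteq> 0\<close> \<open>single e c \<noteq> 0\<close> \<open>c \<noteq> 0\<close>
    by simp
  moreover have "Min (keys v) = e"
    using arg_cong[OF eq, of "\<lambda>f. Min (keys f)"] Min_keys_mul \<open>u \<noteq> 0\<close> \<open>v \<noteq> 0\<close> \<open>single e c \<noteq> 0\<close> \<open>c \<noteq> 0\<close>
    by simp
  ultimately have "keys v \<subseteq> {e}"
    by (metis Max_ge Min_le finite_keys order_antisym subsetI singletonI)
  then have "v = single e (lookup v e)"
    by (intro poly_mapping_eqI) (auto simp: lookup_single when_def in_keys_iff)
  then show ?thesis
    by (rule that)
qed

text \<open>
  Multiplication by a monomial permutes the exponents, so commuting with one up to a factor is a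
  condition on each exponent separately.
\<close>
lemma commute_monomial_iff:
  "u \<star> single e 1 = single e c \<star> u \<longleftrightarrow> (\<forall>n\<in>keys u. \<omega> n e = c * \<omega> e n)"
proof
  assume eq: "u \<star> single e 1 = single e c \<star> u"
  show "\<forall>n\<in>keys u. \<omega> n e = c * \<omega> e n"
  proof
    fix n assume "n \<in> keys u"
    then show "\<omega> n e = c * \<omega> e n"
      using arg_cong[OF eq, of "\<lambda>f. lookup f (n + e)"]
      by (simp add: lookup_mul_single lookup_single_mul in_keys_iff)
  qed
next
  assume "\<forall>n\<in>keys u. \<omega> n e = c * \<omega> e n"
  then have "lookup (u \<star> single e 1) (n + e) = lookup (single e c \<star> u) (n + e)" for n
    by (cases "n \<in> keys u") (auto simp: lookup_mul_single lookup_single_mul in_keys_iff)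
  then have "lookup (u \<star> single e 1) n = lookup (single e c \<star> u) n" for n
    by (metis diff_add_cancel)
  then show "u \<star> single e 1 = single e c \<star> u"
    by (rule poly_mapping_eqI)
qed

end

section \<open>Ideals and quotients of the free algebra\<close>

lemma free_algebra_simps [simp]:
  "carrier free_algebra = UNIV" "f \<otimes>\<^bsub>free_algebra\<^esub> g = f * g" "\<one>\<^bsub>free_algebra\<^esub> = 1"
  "\<zero>\<^bsub>free_algebra\<^esub> = 0" "f \<oplus>\<^bsub>free_algebra\<^esub> g = f + g" "c \<odot>\<^bsub>free_algebra\<^esub> f = c *\<^sub>P f"
  by (simp_all add: free_algebra_def)

lemma a_inv_free_algebra [simp]: "\<ominus>\<^bsub>free_algebra\<^esub> f = - f"
  using abelian_group.minus_equality[OF ring.is_abelian_group[OF ring_free_algebra], of "- f" f]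
  by simp

lemma ideal_free_algebraI:
  fixes I :: "('g, 'k::field) free_alg set"
  assumes "0 \<in> I" "\<And>f g. f \<in> I \<Longrightarrow> g \<in> I \<Longrightarrow> f + g \<in> I"
    and left: "\<And>f g. f \<in> I \<Longrightarrow> g * f \<in> I" and "\<And>f g. f \<in> I \<Longrightarrow> f * g \<in> I"
  shows "ideal I free_algebra"
proof (rule idealI[OF ring_free_algebra])
  show "subgroup I (add_monoid free_algebra)"
  proof
    fix f assume "f \<in> I"
    then show "inv\<^bsub>add_monoid free_algebra\<^esub> f \<in> I"
      using left[of f "- 1"] by (simp only: flip: a_inv_def) simp
  qed (use assms in auto)
qed (use assms in auto)

abbreviation generated_ideal :: "('g, 'k::field) free_alg set \<Rightarrow> ('g, 'k) free_alg set" where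
  "generated_ideal R \<equiv> Idl\<^bsub>free_algebra\<^esub> R"

lemma ideal_generated: "ideal (generated_ideal R) free_algebra"
  by (rule ring.genideal_ideal[OF ring_free_algebra]) simp

lemma generated_ideal_base: "r \<in> R \<Longrightarrow> r \<in> generated_ideal R"
  using ring.genideal_self[OF ring_free_algebra, of R] by auto

lemma generated_ideal_minimal: "ideal I free_algebra \<Longrightarrow> R \<subseteq> I \<Longrightarrow> generated_ideal R \<subseteq> I"
  by (rule ring.genideal_minimal[OF ring_free_algebra])

context
  fixes I :: "('g, 'k::field) free_alg set"
  assumes I: "ideal I free_algebra"
begin

interpretation I: ideal I free_algebra
  by (rule I)

lemma ideal_zero: "0 \<in> I"
  using additive_subgroup.zero_closed[OF I.additive_subgroup_axioms] by simp

lemma ideal_add: "f \<in> I \<Longrightarrow> g \<in> I \<Longrightarrow> f + g \<in> I"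
  using additive_subgroup.a_closed[OF I.additive_subgroup_axioms, of f g] by simp

lemma ideal_mult_left: "f \<in> I \<Longrightarrow> g * f \<in> I"
  and ideal_mult_right: "f \<in> I \<Longrightarrow> f * g \<in> I"
  using I.I_l_closed I.I_r_closed by simp_all

lemma ideal_scl: "f \<in> I \<Longrightarrow> c *\<^sub>P f \<in> I"
  unfolding mult_map_scale_conv_mult by (rule ideal_mult_left)

lemma ideal_uminus: "f \<in> I \<Longrightarrow> - f \<in> I"
  using ideal_scl[of f "- 1"] by (simp add: scl_simps)

lemma ideal_diff: "f \<in> I \<Longrightarrow> g \<in> I \<Longrightarrow> f - g \<in> I"
  using ideal_add[of f "- g"] ideal_uminus[of g] by simp

definition coset :: "('g, 'k) free_alg \<Rightarrow> ('g, 'k) free_alg set" where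
  "coset f = I +>\<^bsub>free_algebra\<^esub> f"

lemma coset_eq_image: "coset f = (\<lambda>i. i + f) ` I"
  by (auto simp: coset_def a_r_coset_def')

lemma mem_coset_iff: "g \<in> coset f \<longleftrightarrow> g - f \<in> I"
  unfolding coset_eq_image by (auto intro: image_eqI[where x = "g - f"])

lemma coset_eq_iff: "coset f = coset g \<longleftrightarrow> f - g \<in> I"
proof
  assume "coset f = coset g"
  then show "f - g \<in> I"
    using mem_coset_iff[of f f] mem_coset_iff[of f g] ideal_zero by simp
next
  assume "f - g \<in> I"
  then have "h - f \<in> I \<longleftrightarrow> h - g \<in> I" for h
    using ideal_add[of "h - f" "f - g"] ideal_diff[of "h - g" "f - g"] by auto
  then show "coset f = coset g"
    by (auto simp: mem_coset_iff)
qed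

lemma quotient_algebra_simps:
  "carrier (quotient_algebra free_algebra I) = range coset"
  "coset f \<otimes>\<^bsub>quotient_algebra free_algebra I\<^esub> coset g = coset (f * g)"
  "coset f \<oplus>\<^bsub>quotient_algebra free_algebra I\<^esub> coset g = coset (f + g)"
  "\<one>\<^bsub>quotient_algebra free_algebra I\<^esub> = coset 1"
  "c \<odot>\<^bsub>quotient_algebra free_algebra I\<^esub> coset f = coset (c *\<^sub>P f)"
proof -
  show "carrier (quotient_algebra free_algebra I) = range coset"
    by (auto simp: quotient_algebra_def ring.defs FactRing_def A_RCOSETS_def' coset_def)
  show "coset f \<otimes>\<^bsub>quotient_algebra free_algebra I\<^esub> coset g = coset (f * g)"
    using I.rcoset_mult_add[of f g]
    by (simp add: quotient_algebra_def ring.defs FactRing_def coset_def)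
  show "coset f \<oplus>\<^bsub>quotient_algebra free_algebra I\<^esub> coset g = coset (f + g)"
    using I.a_rcos_sum[of f g]
    by (simp add: quotient_algebra_def ring.defs FactRing_def coset_def)
  show "\<one>\<^bsub>quotient_algebra free_algebra I\<^esub> = coset 1"
    by (simp add: quotient_algebra_def ring.defs FactRing_def coset_def)
  have "coset (c *\<^sub>P a) = coset (c *\<^sub>P f)" if "a \<in> coset f" for a
    using ideal_scl[of "a - f" c] that by (simp add: coset_eq_iff mem_coset_iff scl_simps)
  moreover have "f \<in> coset f"
    by (simp add: mem_coset_iff ideal_zero)
  ultimately have "(\<Union>a\<in>coset f. coset (c *\<^sub>P a)) = coset (c *\<^sub>P f)"
    by blast
  then show "c \<odot>\<^bsub>quotient_algebra free_algebra I\<^esub> coset f = coset (c *\<^sub>P f)"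
    by (simp add: quotient_algebra_def ring.defs module.defs coset_def)
qed

end

text \<open>
  Mutually inverse substitutions that carry each set of relations into the ideal generated by the other carry the
  ideals onto each other, hence cosets onto cosets.
\<close>
lemma presented_algebra_isomorphicI:
  fixes v :: "'g \<Rightarrow> ('h, 'k::field) free_alg" and w :: "'h \<Rightarrow> ('g, 'k) free_alg"
  assumes v: "free.eval v ` R \<subseteq> generated_ideal S"
    and w: "free.eval w ` S \<subseteq> generated_ideal R"
    and wv: "\<And>g. free.eval w (v g) = var g" and vw: "\<And>h. free.eval v (w h) = var h"
  shows "algebra_isomorphic (presented_algebra R) (presented_algebra S)"
proof -
  let ?I = "generated_ideal R" and ?J = "generated_ideal S"
  note I = ideal_generated[of R] and J = ideal_generated[of S]
  have maps: "free.eval v f \<in> generated_ideal S" if "free.eval v ` R \<subseteq> generated_ideal S" "f \<in> generated_ideal R"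
    for v :: "'a \<Rightarrow> ('b, 'k) free_alg" and R S f
  proof -
    note J = ideal_generated[of S]
    have "ideal {f. free.eval v f \<in> generated_ideal S} free_algebra"
      by (rule ideal_free_algebraI)
        (simp_all add: free.eval_hom ideal_zero[OF J] ideal_add[OF J] ideal_mult_left[OF J] ideal_mult_right[OF J])
    then show ?thesis
      using generated_ideal_minimal[of "{f. free.eval v f \<in> generated_ideal S}" R] that by blast
  qed
  have id: "free.eval w (free.eval v f) = f" if "\<And>g. free.eval w (v g) = var g"
    for v :: "'a \<Rightarrow> ('b, 'k) free_alg" and w :: "'b \<Rightarrow> ('a, 'k) free_alg" and f
  proof -
    have "free.eval w (free.eval v f) = free.eval var f"
      by (rule free.eval_unique) (simp_all add: free.eval_hom that)
    moreover have "f = free.eval var f"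
      by (rule free.eval_unique[of "\<lambda>f. f"]) simp_all
    ultimately show ?thesis
      by simp
  qed
  \<comment> \<open>A coset is mapped to its image under the substitution, which avoids choosing representatives.\<close>
  define h where "h X = free.eval v ` X" for X
  have h: "h (coset ?I f) = coset ?J (free.eval v f)" for f
  proof (intro Set.set_eqI iffI)
    fix g assume "g \<in> h (coset ?I f)"
    then obtain a where "g = free.eval v a" "a - f \<in> ?I"
      by (auto simp: h_def mem_coset_iff[OF I])
    then show "g \<in> coset ?J (free.eval v f)"
      using maps[OF v, of "a - f"] by (simp add: mem_coset_iff[OF J] free.eval_hom)
  next
    fix g assume "g \<in> coset ?J (free.eval v f)"
    then have "free.eval w (g - free.eval v f) \<in> ?I"
      using maps[OF w] by (simp add: mem_coset_iff[OF J])
    then have "free.eval w g \<in> coset ?I f"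
      by (simp add: free.eval_hom id[OF wv] mem_coset_iff[OF I])
    moreover have "g = free.eval v (free.eval w g)"
      by (simp add: id[OF vw])
    ultimately show "g \<in> h (coset ?I f)"
      unfolding h_def by blast
  qed
  have "f - f' \<in> ?I" if "free.eval v f - free.eval v f' \<in> ?J" for f f'
    using maps[OF w that] by (simp add: free.eval_hom id[OF wv])
  then have inj: "inj_on h (range (coset ?I))"
    by (intro inj_onI) (elim imageE, simp add: h coset_eq_iff[OF I] coset_eq_iff[OF J])
  have surj: "h ` range (coset ?I) = range (coset ?J)"
    by (auto simp: h image_iff) (metis id[OF vw])
  show ?thesis
    unfolding algebra_isomorphic_def presented_algebra_def
  proof (intro bexI conjI allI ballI)
    show "h \<in> ring_iso (quotient_algebra free_algebra ?I) (quotient_algebra free_algebra ?J)"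
      by (rule ring_iso_memI)
        (use inj surj in \<open>auto simp: quotient_algebra_simps[OF I] quotient_algebra_simps[OF J] h free.eval_hom bij_betw_def\<close>)
  qed (auto simp: quotient_algebra_simps[OF I] quotient_algebra_simps[OF J] h free.eval_hom)
qed

lemma algebra_isomorphic_trans:
  assumes "algebra_isomorphic A B" "algebra_isomorphic B C"
  shows "algebra_isomorphic A C"
proof -
  obtain f where f: "f \<in> ring_iso A B" "\<And>c a. a \<in> carrier A \<Longrightarrow> f (c \<odot>\<^bsub>A\<^esub> a) = c \<odot>\<^bsub>B\<^esub> f a"
    using assms(1) by (auto simp: algebra_isomorphic_def)
  obtain g where g: "g \<in> ring_iso B C" "\<And>c a. a \<in> carrier B \<Longrightarrow> g (c \<odot>\<^bsub>B\<^esub> a) = c \<odot>\<^bsub>C\<^esub> g a"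
    using assms(2) by (auto simp: algebra_isomorphic_def)
  have "g \<circ> f \<in> ring_iso A C"
    using f(1) g(1) by (rule ring_iso_set_trans)
  moreover have "\<forall>c. \<forall>a\<in>carrier A. (g \<circ> f) (c \<odot>\<^bsub>A\<^esub> a) = c \<odot>\<^bsub>C\<^esub> (g \<circ> f) a"
    using f g(2) ring_iso_memE(1)[OF f(1)] by simp
  ultimately show ?thesis
    unfolding algebra_isomorphic_def by blast
qed

section \<open>The map into the quantum torus\<close>

text \<open>The tuple \<open>(a, b, c, d)\<close> is the exponent of the monomial \<open>z\<^sup>a x\<^sup>b s\<^sup>c t\<^sup>d\<close>.\<close>
type_synonym exponent = "int \<times> int \<times> int \<times> int"

locale quantum_weyl =
  fixes p l m q :: "'k::field"
  assumes nonzero [simp]: "p \<noteq> 0" "l \<noteq> 0" "m \<noteq> 0" "q \<noteq> 0"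
    and p_not_root_of_unity: "\<not> root_of_unity p" and q_not_root_of_unity: "\<not> root_of_unity q"
begin

lemma p_neq_1 [simp]: "p \<noteq> 1" "p - 1 \<noteq> 0"
  using p_not_root_of_unity by (auto simp: root_of_unity_def)

text \<open>
  The factor that results from sorting \<open>z\<^sup>a x\<^sup>b s\<^sup>c t\<^sup>d\<close> times \<open>z\<^sup>a\<^sup>' x\<^sup>b\<^sup>' s\<^sup>c\<^sup>' t\<^sup>d\<^sup>'\<close> by the rules
  \<open>x z = p z x\<close>, \<open>s x = l x s\<close>, \<open>t x = m x t\<close>, \<open>t s = q\<^sup>-\<^sup>1 s t\<close>, where \<open>z\<close> commutes with \<open>s\<close> and \<open>t\<close>.
\<close>
definition cocycle :: "exponent \<Rightarrow> exponent \<Rightarrow> 'k" where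
  "cocycle = (\<lambda>(a, b, c, d) (a', b', c', d').
     p powi (b * a') * l powi (c * b') * m powi (d * b') * q powi (- d * c'))"

lemma cocycle_eq:
  "cocycle (a, b, c, d) (a', b', c', d') =
     p powi (b * a') * l powi (c * b') * m powi (d * b') * q powi (- d * c')"
  by (simp add: cocycle_def)

sublocale twisted_group_algebra cocycle
  by standard (auto simp: cocycle_eq power_int_add power_int_diff power_int_minus field_simps)

text \<open>
  The image of \<open>y\<close> is \<open>(z - 1) / (p - 1) x\<^sup>-\<^sup>1\<close>, the solution of \<open>z = 1 + (p - 1) y x\<close>.
\<close>
definition torus_image :: "gen \<Rightarrow> exponent \<Rightarrow>\<^sub>0 'k" where
  "torus_image g = (case g of
     Gen_x \<Rightarrow> single (0, 1, 0, 0) 1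
   | Gen_y \<Rightarrow> single (1, -1, 0, 0) (1 / (p - 1)) - single (0, -1, 0, 0) (1 / (p - 1))
   | Gen_s \<Rightarrow> single (0, 0, 1, 0) 1
   | Gen_t \<Rightarrow> single (0, 0, 0, 1) 1)"

abbreviation embed :: "(gen, 'k) free_alg \<Rightarrow> exponent \<Rightarrow>\<^sub>0 'k" where
  "embed \<equiv> eval torus_image"

abbreviation relations :: "(gen, 'k) free_alg set" where
  "relations \<equiv> quantum_weyl_relations p l m q"

lemma embed_relation:
  assumes "r \<in> relations"
  shows "embed r = 0"
proof -
  have "\<forall>r\<in>relations. embed r = 0"
    by (simp add: quantum_weyl_relations_def Let_def eval_hom torus_image_def mul_minus minus_mul cocycle_eq
        scl_simps)
      (auto intro!: poly_mapping_eqI simp: lookup_add lookup_minus lookup_single lookup_one zero_prod_def when_def field_simps power_int_minus)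
  then show ?thesis
    using assms by blast
qed

definition normal_word :: "nat \<times> nat \<times> nat \<times> nat \<Rightarrow> (gen, 'k) free_alg" where
  "normal_word = (\<lambda>(i, j, c, d). var Gen_y ^ i * (var Gen_x ^ j * (var Gen_s ^ c * var Gen_t ^ d)))"

lemma embed_power_nonzero: "embed f \<noteq> 0 \<Longrightarrow> embed (f ^ n) \<noteq> 0"
  by (induction n) (simp_all add: eval_mult mul_nonzero)

lemma Max_embed_power:
  assumes "embed f \<noteq> 0" "Max (keys (embed f)) = (a, b, c, d)"
  shows "Max (keys (embed (f ^ n))) = (int n * a, int n * b, int n * c, int n * d)"
proof (induction n)
  case 0
  show ?case
    by (simp add: zero_prod_def)
next
  case (Suc n)
  then show ?case
    using assms by (simp add: eval_mult Max_keys_mul embed_power_nonzero algebra_simps)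
qed

text \<open>In the lexicographic order the leading term of \<open>y\<close> is the one that contains \<open>z\<close>.\<close>
lemma Max_torus_image:
  "Max (keys (torus_image g)) =
     (case g of Gen_x \<Rightarrow> (0, 1, 0, 0) | Gen_y \<Rightarrow> (1, -1, 0, 0) | Gen_s \<Rightarrow> (0, 0, 1, 0) | Gen_t \<Rightarrow> (0, 0, 0, 1))"
  and torus_image_nonzero: "torus_image g \<noteq> 0"
proof -
  have "keys (torus_image Gen_y) = {(1, -1, 0, 0), (0, -1, 0, 0)}"
    by (auto simp: torus_image_def in_keys_iff lookup_minus lookup_single when_def split: if_splits)
  then show M: "Max (keys (torus_image g)) =
     (case g of Gen_x \<Rightarrow> (0, 1, 0, 0) | Gen_y \<Rightarrow> (1, -1, 0, 0) | Gen_s \<Rightarrow> (0, 0, 1, 0) | Gen_t \<Rightarrow> (0, 0, 0, 1))"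
    and "torus_image g \<noteq> 0"
    by (cases g; auto simp: torus_image_def max_def)+
qed

lemma embed_normal_word_nonzero: "embed (normal_word k) \<noteq> 0"
  and Max_embed_normal_word:
    "Max (keys (embed (normal_word (i, j, c, d)))) = (int i, int j - int i, int c, int d)"
proof -
  have generator: "embed (var g) \<noteq> 0" for g
    by (simp add: torus_image_nonzero)
  note nonzero_power = embed_power_nonzero[OF generator]
  show "embed (normal_word k) \<noteq> 0"
    by (cases k) (simp add: normal_word_def eval_mult mul_nonzero nonzero_power)
  have "Max (keys (embed (var Gen_y ^ i))) = (int i, - int i, 0, 0)"
    "Max (keys (embed (var Gen_x ^ j))) = (0, int j, 0, 0)"
    "Max (keys (embed (var Gen_s ^ c))) = (0, 0, int c, 0)"
    "Max (keys (embed (var Gen_t ^ d))) = (0, 0, 0, int d)"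
    using Max_embed_power[OF generator[of Gen_y], of 1 "-1" 0 0 i]
      Max_embed_power[OF generator[of Gen_x], of 0 1 0 0 j]
      Max_embed_power[OF generator[of Gen_s], of 0 0 1 0 c]
      Max_embed_power[OF generator[of Gen_t], of 0 0 0 1 d]
    by (simp_all add: Max_torus_image)
  then show "Max (keys (embed (normal_word (i, j, c, d)))) = (int i, int j - int i, int c, int d)"
    by (simp add: normal_word_def eval_mult Max_keys_mul mul_nonzero nonzero_power)
qed

lemma embed_lin: "embed (lin \<phi> f) = lin (\<lambda>a. embed (\<phi> a)) f"
  by (induction f rule: poly_mapping_additive_induct) (simp_all add: lin_add eval_hom)

lemma
  assumes "f \<noteq> 0"
  shows embed_lin_normal_word_nonzero: "embed (lin normal_word f) \<noteq> 0"
    and Max_embed_lin_normal_word: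
      "\<exists>i j c d. Max (keys (embed (lin normal_word f))) = (int i, int j - int i, int c, int d)"
proof -
  have inj: "inj (\<lambda>k. Max (keys (embed (normal_word k))))"
    by (rule injI) (auto simp: Max_embed_normal_word)
  show "embed (lin normal_word f) \<noteq> 0"
    unfolding embed_lin using inj assms by (intro lin_nonzero embed_normal_word_nonzero)
  show "\<exists>i j c d. Max (keys (embed (lin normal_word f))) = (int i, int j - int i, int c, int d)"
    unfolding embed_lin
    using Max_keys_lin[OF embed_normal_word_nonzero inj assms] by (auto simp: Max_embed_normal_word)
qed

section \<open>Normal words span the algebra\<close>

definition cong_relations :: "(gen, 'k) free_alg \<Rightarrow> (gen, 'k) free_alg \<Rightarrow> bool"  (infix \<open>\<approx>\<close> 50) where
  "f \<approx> g \<longleftrightarrow> f - g \<in> generated_ideal relations"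

lemma cong_refl [simp]: "f \<approx> f"
  by (simp add: cong_relations_def ideal_zero[OF ideal_generated])

lemma cong_sym: "f \<approx> g \<Longrightarrow> g \<approx> f"
  using ideal_uminus[OF ideal_generated, of "f - g"] by (simp add: cong_relations_def)

lemma cong_trans [trans]: "f \<approx> g \<Longrightarrow> g \<approx> h \<Longrightarrow> f \<approx> h"
  using ideal_add[OF ideal_generated, of "f - g" _ "g - h"] by (simp add: cong_relations_def)

lemma cong_add: "f \<approx> f' \<Longrightarrow> g \<approx> g' \<Longrightarrow> f + g \<approx> f' + g'"
  using ideal_add[OF ideal_generated, of "f - f'" _ "g - g'"] by (simp add: cong_relations_def algebra_simps)

lemma cong_scl: "f \<approx> f' \<Longrightarrow> c *\<^sub>P f \<approx> c *\<^sub>P f'"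
  using ideal_scl[OF ideal_generated, of "f - f'"] by (simp add: cong_relations_def scl_simps)

lemma cong_mult_left: "f \<approx> f' \<Longrightarrow> g * f \<approx> g * f'"
  using ideal_mult_left[OF ideal_generated, of "f - f'"] by (simp add: cong_relations_def right_diff_distrib)

lemma cong_mult_right: "f \<approx> f' \<Longrightarrow> f * g \<approx> f' * g"
  using ideal_mult_right[OF ideal_generated, of "f - f'"] by (simp add: cong_relations_def left_diff_distrib)

lemma cong_generators:
  "var Gen_x * var Gen_y \<approx> p *\<^sub>P (var Gen_y * var Gen_x) + 1"
  "var Gen_s * var Gen_t \<approx> q *\<^sub>P (var Gen_t * var Gen_s)"
  "var Gen_s * var Gen_x \<approx> l *\<^sub>P (var Gen_x * var Gen_s)"
  "var Gen_s * var Gen_y \<approx> inverse l *\<^sub>P (var Gen_y * var Gen_s)"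
  "var Gen_t * var Gen_x \<approx> m *\<^sub>P (var Gen_x * var Gen_t)"
  "var Gen_t * var Gen_y \<approx> inverse m *\<^sub>P (var Gen_y * var Gen_t)"
  by (simp_all only: cong_relations_def diff_diff_eq[symmetric])
    (rule generated_ideal_base; simp add: quantum_weyl_relations_def Let_def)+

lemma power_commute:
  assumes "u * g \<approx> c *\<^sub>P (g * u)"
  shows "u ^ n * g \<approx> (c ^ n) *\<^sub>P (g * u ^ n)"
proof (induction n)
  case (Suc n)
  have "u ^ Suc n * g = u * (u ^ n * g)"
    by (simp add: mult.assoc)
  also have "\<dots> \<approx> u * (c ^ n *\<^sub>P (g * u ^ n))"
    by (rule cong_mult_left) (rule Suc)
  also have "u * (c ^ n *\<^sub>P (g * u ^ n)) = c ^ n *\<^sub>P (u * g * u ^ n)"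
    by (simp only: free.mul_scl mult.assoc)
  also have "\<dots> \<approx> c ^ n *\<^sub>P (c *\<^sub>P (g * u) * u ^ n)"
    by (intro cong_scl cong_mult_right assms)
  also have "c ^ n *\<^sub>P (c *\<^sub>P (g * u) * u ^ n) = c ^ Suc n *\<^sub>P (g * u ^ Suc n)"
    by (simp add: free.scl_mul scl_simps mult.assoc mult.commute)
  finally show ?case .
qed simp

text \<open>
  Moving \<open>y\<close> to the left through \<open>x ^ Suc j\<close> produces one term of lower degree. Only the shape of the
  result matters, so the coefficients (a power of \<open>p\<close> and the \<open>p\<close>-analogue of a natural number) stay existential.
\<close>
lemma x_power_y:
  "\<exists>\<alpha> \<beta>. var Gen_x ^ Suc j * var Gen_y \<approx> \<alpha> *\<^sub>P (var Gen_y * var Gen_x ^ Suc j) + \<beta> *\<^sub>P (var Gen_x ^ j)"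
proof (induction j)
  case 0
  have "var Gen_x ^ Suc 0 * var Gen_y \<approx> p *\<^sub>P (var Gen_y * var Gen_x ^ Suc 0) + 1 *\<^sub>P (var Gen_x ^ 0)"
    using cong_generators(1) by simp
  then show ?case
    by blast
next
  case (Suc j)
  let ?x = "var Gen_x :: (gen, 'k) free_alg" and ?y = "var Gen_y :: (gen, 'k) free_alg"
  from Suc obtain \<alpha> \<beta> where IH: "?x ^ Suc j * ?y \<approx> \<alpha> *\<^sub>P (?y * ?x ^ Suc j) + \<beta> *\<^sub>P (?x ^ j)"
    by blast
  have "?x ^ Suc (Suc j) * ?y = ?x * (?x ^ Suc j * ?y)"
    by (simp add: mult.assoc)
  also have "\<dots> \<approx> ?x * (\<alpha> *\<^sub>P (?y * ?x ^ Suc j) + \<beta> *\<^sub>P (?x ^ j))"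
    by (rule cong_mult_left) (rule IH)
  also have "\<dots> = \<alpha> *\<^sub>P (?x * ?y * ?x ^ Suc j) + \<beta> *\<^sub>P (?x ^ Suc j)"
    by (simp add: ring_distribs free.mul_scl mult.assoc)
  also have "\<dots> \<approx> \<alpha> *\<^sub>P ((p *\<^sub>P (?y * ?x) + 1) * ?x ^ Suc j) + \<beta> *\<^sub>P (?x ^ Suc j)"
    by (intro cong_add cong_scl cong_mult_right cong_generators cong_refl)
  also have "\<dots> = (\<alpha> * p) *\<^sub>P (?y * ?x ^ Suc (Suc j)) + (\<alpha> + \<beta>) *\<^sub>P (?x ^ Suc j)"
    by (simp add: ring_distribs free.scl_mul scl_simps mult.assoc)
  finally show ?case
    by blast
qed

definition normal_span :: "(gen, 'k) free_alg set" where
  "normal_span = {f. \<exists>n. f \<approx> lin normal_word n}"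

lemma normal_span_word: "normal_word k \<in> normal_span"
  unfolding normal_span_def by (auto intro!: exI[of _ "single k 1"])

lemma normal_span_scl: "f \<in> normal_span \<Longrightarrow> c *\<^sub>P f \<in> normal_span"
  unfolding normal_span_def mem_Collect_eq by (metis lin_scl cong_scl)

lemma normal_span_add: "f \<in> normal_span \<Longrightarrow> g \<in> normal_span \<Longrightarrow> f + g \<in> normal_span"
  unfolding normal_span_def mem_Collect_eq by (metis lin_add cong_add)

lemma normal_span_cong: "f \<approx> g \<Longrightarrow> g \<in> normal_span \<Longrightarrow> f \<in> normal_span"
  unfolding normal_span_def by (blast intro: cong_trans)

text \<open>
  A generator is moved from the right end to its place in the sorted word. It passes \<open>s\<close> and \<open>t\<close> up to a
  factor; only \<open>y\<close> passing \<open>x\<close> leaves a second normal word.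
\<close>
lemma normal_word_mult: "normal_word k * var g \<in> normal_span"
proof -
  obtain i j c d where k: "k = (i, j, c, d)"
    by (cases k)
  let ?x = "var Gen_x :: (gen, 'k) free_alg" and ?y = "var Gen_y :: (gen, 'k) free_alg"
    and ?s = "var Gen_s :: (gen, 'k) free_alg" and ?t = "var Gen_t :: (gen, 'k) free_alg"
  have past_st: "normal_word k * g \<approx> (a ^ c * b ^ d) *\<^sub>P (?y ^ i * (?x ^ j * g) * (?s ^ c * ?t ^ d))"
    if "?s * g \<approx> a *\<^sub>P (g * ?s)" "?t * g \<approx> b *\<^sub>P (g * ?t)" for g a b
  proof -
    have "normal_word k * g = ?y ^ i * ?x ^ j * ?s ^ c * (?t ^ d * g)"
      by (simp add: k normal_word_def mult.assoc)
    also have "\<dots> \<approx> ?y ^ i * ?x ^ j * ?s ^ c * (b ^ d *\<^sub>P (g * ?t ^ d))"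
      by (intro cong_mult_left power_commute that)
    also have "\<dots> = b ^ d *\<^sub>P (?y ^ i * ?x ^ j * (?s ^ c * g) * ?t ^ d)"
      by (simp add: free.mul_scl mult.assoc)
    also have "\<dots> \<approx> b ^ d *\<^sub>P (?y ^ i * ?x ^ j * (a ^ c *\<^sub>P (g * ?s ^ c)) * ?t ^ d)"
      by (intro cong_mult_left cong_mult_right cong_scl power_commute that)
    also have "\<dots> = (a ^ c * b ^ d) *\<^sub>P (?y ^ i * (?x ^ j * g) * (?s ^ c * ?t ^ d))"
      by (simp add: free.mul_scl free.scl_mul scl_simps mult.assoc mult.commute)
    finally show ?thesis .
  qed
  show ?thesis
  proof (cases g)
    case Gen_t
    have "normal_word k * ?t = normal_word (i, j, c, Suc d)"
      by (simp add: k normal_word_def mult.assoc flip: power_Suc2)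
    then show ?thesis
      by (simp add: Gen_t normal_span_word)
  next
    case Gen_s
    have "?t * ?s \<approx> inverse q *\<^sub>P (?s * ?t)"
      using cong_scl[OF cong_generators(2), of "inverse q"] by (simp add: scl_simps cong_sym)
    then have "?t ^ d * ?s \<approx> (inverse q ^ d) *\<^sub>P (?s * ?t ^ d)"
      by (rule power_commute)
    then have "?y ^ i * ?x ^ j * ?s ^ c * (?t ^ d * ?s) \<approx>
        ?y ^ i * ?x ^ j * ?s ^ c * ((inverse q ^ d) *\<^sub>P (?s * ?t ^ d))"
      by (rule cong_mult_left)
    moreover have "?y ^ i * ?x ^ j * ?s ^ c * ((inverse q ^ d) *\<^sub>P (?s * ?t ^ d)) =
        (inverse q ^ d) *\<^sub>P (?y ^ i * ?x ^ j * (?s ^ c * ?s) * ?t ^ d)"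
      by (simp only: free.mul_scl mult.assoc)
    moreover have "\<dots> = (inverse q ^ d) *\<^sub>P normal_word (i, j, Suc c, d)"
      by (simp only: normal_word_def prod.case mult.assoc power_Suc2)
    moreover have "normal_word k * ?s = ?y ^ i * ?x ^ j * ?s ^ c * (?t ^ d * ?s)"
      by (simp add: k normal_word_def mult.assoc)
    ultimately show ?thesis
      unfolding Gen_s by (metis normal_span_cong normal_span_scl normal_span_word)
  next
    case Gen_x
    have "?y ^ i * (?x ^ j * ?x) * (?s ^ c * ?t ^ d) = normal_word (i, Suc j, c, d)"
      by (simp only: normal_word_def prod.case mult.assoc power_Suc2)
    then show ?thesis
      using past_st[OF cong_generators(3,5)] unfolding Gen_x
      by (metis normal_span_cong normal_span_scl normal_span_word)
  next
    case Gen_y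
    have "?y ^ i * (?x ^ j * ?y) * (?s ^ c * ?t ^ d) \<in> normal_span"
    proof (cases j)
      case 0
      then have "?y ^ i * (?x ^ j * ?y) * (?s ^ c * ?t ^ d) = normal_word (Suc i, 0, c, d)"
        by (simp add: normal_word_def mult.assoc power_commutes)
      then show ?thesis
        by (simp add: normal_span_word)
    next
      case (Suc j')
      obtain \<alpha> \<beta> where "?x ^ j * ?y \<approx> \<alpha> *\<^sub>P (?y * ?x ^ j) + \<beta> *\<^sub>P (?x ^ j')"
        using x_power_y Suc by blast
      then have "?y ^ i * (?x ^ j * ?y) * (?s ^ c * ?t ^ d) \<approx>
          ?y ^ i * (\<alpha> *\<^sub>P (?y * ?x ^ j) + \<beta> *\<^sub>P (?x ^ j')) * (?s ^ c * ?t ^ d)"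
        by (intro cong_mult_left cong_mult_right)
      also have "\<dots> = \<alpha> *\<^sub>P (?y ^ i * ?y * ?x ^ j * (?s ^ c * ?t ^ d)) + \<beta> *\<^sub>P (?y ^ i * ?x ^ j' * (?s ^ c * ?t ^ d))"
        by (simp add: ring_distribs free.mul_scl free.scl_mul mult.assoc)
      also have "\<dots> = \<alpha> *\<^sub>P normal_word (Suc i, j, c, d) + \<beta> *\<^sub>P normal_word (i, j', c, d)"
        by (simp only: normal_word_def prod.case mult.assoc power_Suc2)
      finally show ?thesis
        by (rule normal_span_cong) (intro normal_span_add normal_span_scl normal_span_word)
    qed
    then show ?thesis
      using past_st[OF cong_generators(4,6)] unfolding Gen_y
      by (metis normal_span_cong normal_span_scl)
  qed
qed

lemma normal_span_mult:
  assumes "f \<in> normal_span"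
  shows "f * var g \<in> normal_span"
proof -
  obtain n where n: "f \<approx> lin normal_word n"
    using assms by (auto simp: normal_span_def)
  have "lin normal_word n * var g \<in> normal_span"
  proof (induction n rule: poly_mapping_additive_induct)
    case zero
    show ?case
      using normal_span_scl[OF normal_span_word, of 0] by simp
  next
    case (single k c)
    show ?case
      by (simp add: free.scl_mul normal_span_scl normal_word_mult)
  next
    case (add n n')
    then show ?case
      by (simp add: lin_add ring_distribs normal_span_add)
  qed
  then show ?thesis
    using cong_mult_right[OF n] normal_span_cong by blast
qed

lemma normal_words_span: "f \<in> normal_span"
proof (induction f rule: poly_mapping_additive_induct)
  case zero
  show ?case
    using normal_span_scl[OF normal_span_word, of 0] by simp
next
  case (single w c)
  have "single (Word xs) 1 \<in> normal_span" for xs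
  proof (induction xs rule: rev_induct)
    case Nil
    have "single (Word []) 1 = normal_word (0, 0, 0, 0)"
      by (simp add: normal_word_def flip: zero_word_def)
    then show ?case
      by (simp add: normal_span_word)
  next
    case (snoc g xs)
    have "single (Word (xs @ [g])) 1 = (single (Word xs) 1 * var g :: (gen, 'k) free_alg)"
      by (simp add: var_def mult_single plus_word_def)
    then show ?case
      by (simp add: normal_span_mult[OF snoc])
  qed
  then have "c *\<^sub>P single w 1 \<in> normal_span"
    by (metis word.exhaust normal_span_scl)
  then show ?case
    by simp
qed (rule normal_span_add)

text \<open>
  The relations vanish in the torus. Conversely, an element of the kernel is congruent to a combination of
  normal words that vanishes in the torus, and the images of normal words are linearly independent.
\<close>
lemma embed_eq_zero_iff: "embed f = 0 \<longleftrightarrow> f \<in> generated_ideal relations"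
proof
  have "ideal {f. embed f = 0} free_algebra"
    by (rule ideal_free_algebraI) (simp_all add: eval_hom)
  then have ideal_kernel: "generated_ideal relations \<subseteq> {f. embed f = 0}"
    by (rule generated_ideal_minimal) (use embed_relation in blast)
  then show "embed f = 0" if "f \<in> generated_ideal relations"
    using that by blast
  obtain n where n: "f - lin normal_word n \<in> generated_ideal relations"
    using normal_words_span[of f] by (auto simp: normal_span_def cong_relations_def)
  then have "embed f = embed (lin normal_word n)"
    using ideal_kernel by (auto simp: eval_hom)
  then show "f \<in> generated_ideal relations" if "embed f = 0"
    using that n embed_lin_normal_word_nonzero[of n] by (cases "n = 0") auto
qed

text \<open>
  The cone of leading exponents, which tells elements of the algebra apart from other elements of the torus;
  for instance, it excludes \<open>x\<^sup>-\<^sup>1\<close>.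
\<close>
lemma Max_keys_embed:
  assumes "embed f \<noteq> 0"
  obtains i j c d where "Max (keys (embed f)) = (int i, int j - int i, int c, int d)"
proof -
  obtain n where "f - lin normal_word n \<in> generated_ideal relations"
    using normal_words_span[of f] by (auto simp: normal_span_def cong_relations_def)
  then have eq: "embed f = embed (lin normal_word n)"
    using embed_eq_zero_iff[of "f - lin normal_word n"] by (simp add: eval_hom)
  with assms have "n \<noteq> 0"
    by auto
  show ?thesis
    using Max_embed_lin_normal_word[OF \<open>n \<noteq> 0\<close>] that unfolding eq by blast
qed

end

section \<open>Normal elements\<close>

lemma power_int_eq_1_iff:
  fixes p :: "'k::field"
  assumes "p \<noteq> 0" "\<not> root_of_unity p"
  shows "p powi n = 1 \<longleftrightarrow> n = 0"
proof
  assume *: "p powi n = 1"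
  have "p powi (int (nat \<bar>n\<bar>)) = 1"
    using * by (cases "n \<ge> 0") (auto simp: power_int_minus)
  then have "p ^ nat \<bar>n\<bar> = 1"
    by (simp only: power_int_of_nat)
  then show "n = 0"
    using assms(2) unfolding root_of_unity_def by (metis gr0I nat_0_iff abs_le_zero_iff)
qed simp

lemma power_int_inj:
  fixes p :: "'k::field"
  assumes "p \<noteq> 0" "\<not> root_of_unity p"
  shows "p powi n = p powi n' \<longleftrightarrow> n = n'"
  using power_int_eq_1_iff[OF assms, of "n - n'"] assms(1) by (auto simp: power_int_diff)

abbreviation "exp_z \<equiv> (1, 0, 0, 0) :: exponent"
abbreviation "exp_x \<equiv> (0, 1, 0, 0) :: exponent"
abbreviation "exp_s \<equiv> (0, 0, 1, 0) :: exponent"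
abbreviation "exp_t \<equiv> (0, 0, 0, 1) :: exponent"

text \<open>
  The exponents of the normal elements \<open>z\<^sup>a s\<^sup>c t\<^sup>d\<close>. They form a free commutative monoid on \<open>exp_z\<close>,
  \<open>exp_s\<close>, \<open>exp_t\<close>; the next lemmas say that these three are its indecomposable elements.
\<close>
definition normal_exponents :: "exponent set" where
  "normal_exponents = {(a, 0, c, d) | a c d. 0 \<le> a \<and> 0 \<le> c \<and> 0 \<le> d}"

lemma normal_exponents_generators [simp]:
  "exp_z \<in> normal_exponents" "exp_s \<in> normal_exponents" "exp_t \<in> normal_exponents"
  by (simp_all add: normal_exponents_def)

lemma normal_exponents_decompose:
  assumes "n \<in> normal_exponents" "n \<noteq> 0" "n \<notin> {exp_z, exp_s, exp_t}"
  obtains f g where "f \<in> normal_exponents" "g \<in> normal_exponents" "f \<noteq> 0" "g \<noteq> 0" "n = f + g"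
proof -
  obtain a c d where n: "n = (a, 0, c, d)" "0 \<le> a" "0 \<le> c" "0 \<le> d"
    using assms(1) by (auto simp: normal_exponents_def)
  have "a > 0 \<or> c > 0 \<or> d > 0"
    using n assms(2) by (auto simp: zero_prod_def)
  then have "\<exists>f\<in>{exp_z, exp_s, exp_t}. n - f \<in> normal_exponents"
    using n by (auto simp: normal_exponents_def)
  then obtain f where f: "f \<in> {exp_z, exp_s, exp_t}" "n - f \<in> normal_exponents"
    by blast
  moreover have "n - f \<noteq> 0"
    using f(1) assms(3) by (metis eq_iff_diff_eq_0)
  moreover have "f \<noteq> 0"
    using f(1) by (auto simp: zero_prod_def)
  ultimately show ?thesis
    by (intro that[of f "n - f"]) auto
qed

lemma normal_exponents_indecomposable:
  assumes "f \<in> normal_exponents" "g \<in> normal_exponents" "f + g \<in> {exp_z, exp_s, exp_t}"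
  shows "f = 0 \<or> g = 0"
  using assms by (auto simp: normal_exponents_def zero_prod_def)

context quantum_weyl
begin

lemmas p_powi_inj [simp] = power_int_inj[OF nonzero(1) p_not_root_of_unity]
lemmas q_powi_inj [simp] = power_int_inj[OF nonzero(4) q_not_root_of_unity]

definition subalgebra :: "(exponent \<Rightarrow>\<^sub>0 'k) set" where
  "subalgebra = range embed"

lemma subalgebra_closed:
  "1 \<in> subalgebra" "torus_image g \<in> subalgebra"
  "u \<in> subalgebra \<Longrightarrow> v \<in> subalgebra \<Longrightarrow> u + v \<in> subalgebra"
  "u \<in> subalgebra \<Longrightarrow> v \<in> subalgebra \<Longrightarrow> u - v \<in> subalgebra"
  "u \<in> subalgebra \<Longrightarrow> v \<in> subalgebra \<Longrightarrow> mul u v \<in> subalgebra"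
  "u \<in> subalgebra \<Longrightarrow> c *\<^sub>P u \<in> subalgebra"
  by (auto simp: subalgebra_def simp flip: eval_hom intro: range_eqI[of _ _ 1] range_eqI[of _ _ "var g"])

lemma monomial_z_in_subalgebra: "single exp_z 1 \<in> subalgebra"
proof -
  have "single exp_z 1 = 1 + (p - 1) *\<^sub>P mul (torus_image Gen_y) (torus_image Gen_x)"
    by (rule poly_mapping_eqI)
      (auto simp: torus_image_def minus_mul cocycle_eq scl_simps lookup_add lookup_minus lookup_single
        lookup_one zero_prod_def when_def)
  then show ?thesis
    by (simp add: subalgebra_closed)
qed

lemma torus_image_monomials [simp]: "torus_image Gen_x = single exp_x 1"
  "torus_image Gen_s = single exp_s 1" "torus_image Gen_t = single exp_t 1"
  by (simp_all add: torus_image_def)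

lemma monomial_in_subalgebra:
  assumes "n \<in> normal_exponents"
  shows "single n k \<in> subalgebra"
proof -
  have "single (int a, 0, int c, int d) 1 \<in> subalgebra" for a c d
  proof (induction a)
    case 0
    show ?case
    proof (induction c)
      case 0
      show ?case
      proof (induction d)
        case 0
        show ?case
          using subalgebra_closed(1) by (simp add: zero_prod_def[symmetric])
      next
        case (Suc d)
        have "single (int 0, 0, int 0, int (Suc d)) 1 = mul (torus_image Gen_t) (single (int 0, 0, int 0, int d) 1)"
          by (simp add: cocycle_eq)
        then show ?case
          using Suc by (simp only: subalgebra_closed)
      qed
    next
      case (Suc c)
      have "single (int 0, 0, int (Suc c), int d) 1 = mul (torus_image Gen_s) (single (int 0, 0, int c, int d) 1)"
        by (simp add: cocycle_eq)
      then show ?case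
        using Suc by (simp only: subalgebra_closed)
    qed
  next
    case (Suc a)
    have "single (int (Suc a), 0, int c, int d) 1 = mul (single exp_z 1) (single (int a, 0, int c, int d) 1)"
      by (simp add: cocycle_eq)
    then show ?case
      using Suc monomial_z_in_subalgebra by (simp only: subalgebra_closed)
  qed
  moreover obtain a c d where "n = (int a, 0, int c, int d)"
    using assms unfolding normal_exponents_def by (auto elim!: nonneg_int_cases)
  ultimately have "k *\<^sub>P single n 1 \<in> subalgebra"
    by (simp only: subalgebra_closed)
  then show ?thesis
    by simp
qed

text \<open>
  Writing B for the subalgebra, the condition is \<open>u B \<subseteq> B u\<close>. It can be verified on generators, and isomorphisms
  preserve it.
\<close>
definition normal :: "(exponent \<Rightarrow>\<^sub>0 'k) \<Rightarrow> bool" where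
  "normal u \<longleftrightarrow> u \<in> subalgebra \<and> u \<noteq> 0 \<and> (\<forall>b\<in>subalgebra. \<exists>b'\<in>subalgebra. mul u b = mul b' u)"

lemma normal_conjugate:
  assumes "normal u" "b \<in> subalgebra"
  obtains b' where "b' \<in> subalgebra" "mul u b = mul b' u"
  using assms(1)[unfolded normal_def, THEN conjunct2, THEN conjunct2, rule_format, OF assms(2)]
  by (elim bexE) (rule that)

text \<open>
  Such a monomial commutes with every generator up to a factor. For \<open>y\<close> this is so because both of its terms have the
  same \<open>x\<close>-degree and the monomial commutes with \<open>z\<close>.
\<close>
lemma monomial_normal:
  assumes "n \<in> normal_exponents" "k \<noteq> 0"
  shows "normal (single n k)"
proof -
  obtain a c d where n: "n = (a, 0, c, d)"
    using assms(1) by (auto simp: normal_exponents_def)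
  let ?u = "single n k"
  have generator: "\<exists>\<kappa>. mul ?u (torus_image g) = \<kappa> *\<^sub>P mul (torus_image g) ?u" for g
  proof (cases g)
    case Gen_x
    then show ?thesis
      by (intro exI[of _ "l powi c * m powi d * p powi - a"]) (simp add: n cocycle_eq power_int_minus mult_ac)
  next
    case Gen_y
    show ?thesis
      unfolding Gen_y torus_image_def gen.case n mul_minus minus_mul mul_single_single scl_simps scl_single
      by (intro exI[of _ "l powi - c * m powi - d * p powi a"] arg_cong2[of _ _ _ _ "(-)"] arg_cong2[of _ _ _ _ single])
        (simp_all add: cocycle_eq power_int_minus field_simps)
  next
    case Gen_s
    then show ?thesis
      by (intro exI[of _ "q powi - d"]) (simp add: n cocycle_eq add.commute mult.commute)
  next
    case Gen_t
    then show ?thesis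
      by (intro exI[of _ "q powi c"]) (simp add: n cocycle_eq power_int_minus add.commute field_simps)
  qed
  have "\<exists>b'\<in>subalgebra. mul ?u (embed f) = mul b' ?u" for f
  proof (induction f rule: free_algebra_induct)
    case one
    show ?case
      by (intro bexI[of _ 1]) (simp_all add: subalgebra_closed)
  next
    case (var g)
    obtain \<kappa> where "mul ?u (torus_image g) = \<kappa> *\<^sub>P mul (torus_image g) ?u"
      using generator by blast
    then show ?case
      by (intro bexI[of _ "\<kappa> *\<^sub>P torus_image g"]) (simp_all add: subalgebra_closed scl_mul)
  next
    case (scl c f)
    then obtain b' where "b' \<in> subalgebra" "mul ?u (embed f) = mul b' ?u"
      by blast
    then show ?case
      by (intro bexI[of _ "c *\<^sub>P b'"]) (simp_all add: subalgebra_closed scl_mul mul_scl eval_hom)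
  next
    case (add f g)
    then obtain b' b'' where "b' \<in> subalgebra" "mul ?u (embed f) = mul b' ?u"
        "b'' \<in> subalgebra" "mul ?u (embed g) = mul b'' ?u"
      by blast
    then show ?case
      by (intro bexI[of _ "b' + b''"]) (simp_all add: subalgebra_closed add_mul mul_add eval_hom)
  next
    case (mult f g)
    then obtain b' b'' where b: "b' \<in> subalgebra" "mul ?u (embed f) = mul b' ?u"
        "b'' \<in> subalgebra" "mul ?u (embed g) = mul b'' ?u"
      by blast
    have "mul ?u (embed (f * g)) = mul (mul b' b'') ?u"
      by (simp only: eval_mult mul_assoc[symmetric] b(2)) (simp only: mul_assoc b(4))
    then show ?case
      using b(1,3) subalgebra_closed(5) by blast
  qed
  then show ?thesis
    using monomial_in_subalgebra[OF assms(1)] assms(2) by (auto simp: normal_def subalgebra_def)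
qed

lemma Max_keys_subalgebra:
  assumes "u \<in> subalgebra" "u \<noteq> 0"
  obtains i j c d where "Max (keys u) = (int i, int j - int i, int c, int d)"
proof -
  obtain f where "u = embed f"
    using assms(1) by (auto simp: subalgebra_def)
  with assms(2) that show ?thesis
    using Max_keys_embed[of f] by metis
qed

text \<open>
  A normal element commutes up to a factor with \<open>z, x, s, t\<close>, which allows only one exponent; that this exponent has
  \<open>x\<close>-degree 0 follows from conjugating \<open>y\<close>.
\<close>
lemma normal_imp_monomial:
  assumes "normal u"
  obtains n k where "n \<in> normal_exponents" "k \<noteq> 0" "u = single n k"
proof -
  have u: "u \<in> subalgebra" "u \<noteq> 0"
    using assms by (simp_all add: normal_def)
  have commute: "cocycle n e * cocycle e n' = cocycle n' e * cocycle e n"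
    if e: "single e 1 \<in> subalgebra" and n: "n \<in> keys u" "n' \<in> keys u" for n n' e
  proof -
    obtain b' where b': "b' \<in> subalgebra" "mul u (single e 1) = mul b' u"
      by (rule normal_conjugate[OF assms e])
    obtain k where "b' = single e k"
      using b'(2) by (rule conjugate_monomial[OF u(2) one_neq_zero])
    then have "mul u (single e 1) = mul (single e k) u"
      using b'(2) by simp
    then have "\<forall>n\<in>keys u. cocycle n e = k * cocycle e n"
      by (simp only: commute_monomial_iff)
    then have *: "cocycle n e = k * cocycle e n" "cocycle n' e = k * cocycle e n'"
      using n by (auto dest: bspec)
    show ?thesis
      unfolding * by (simp only: mult_ac)
  qed
  have generators: "single e 1 \<in> subalgebra" if "e \<in> {exp_z, exp_x, exp_s, exp_t}" for e
    using that monomial_z_in_subalgebra subalgebra_closed(2)[of Gen_x] subalgebra_closed(2)[of Gen_s]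
      subalgebra_closed(2)[of Gen_t] by auto
  \<comment> \<open>The commutation factor with \<open>z\<close> determines \<open>b\<close>, then those with \<open>s\<close>, \<open>t\<close>, \<open>x\<close> determine \<open>d\<close>, \<open>c\<close>, \<open>a\<close>.\<close>
  have unique: "n = n'" if n: "n \<in> keys u" "n' \<in> keys u" for n n'
  proof -
    obtain a b c d where n_eq: "n = (a, b, c, d)"
      by (cases n)
    obtain a' b' c' d' where n'_eq: "n' = (a', b', c', d')"
      by (cases n')
    have b: "b = b'"
      using commute[OF generators n, of exp_z] by (simp add: n_eq n'_eq cocycle_eq)
    have d: "d = d'"
      using commute[OF generators n, of exp_s] by (simp add: n_eq n'_eq b cocycle_eq)
    have c: "c = c'"
      using commute[OF generators n, of exp_t] by (simp add: n_eq n'_eq b cocycle_eq)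
    have "a = a'"
      using commute[OF generators n, of exp_x] by (simp add: n_eq n'_eq b c d cocycle_eq)
    with b c d show ?thesis
      by (simp add: n_eq n'_eq)
  qed
  obtain i j c' d' where max: "Max (keys u) = (int i, int j - int i, int c', int d')"
    using u by (rule Max_keys_subalgebra)
  define n where "n = Max (keys u)"
  define k where "k = lookup u n"
  have "n \<in> keys u"
    unfolding n_def using u(2) by (rule Max_keys_in)
  then have "k \<noteq> 0"
    by (simp add: k_def in_keys_iff)
  have "lookup u n' = 0" if "n' \<noteq> n" for n'
    using unique[OF _ \<open>n \<in> keys u\<close>, of n'] that by (metis in_keys_iff)
  then have u_eq: "u = single n k"
    unfolding k_def by (intro poly_mapping_eqI) (metis lookup_single_eq lookup_single_not_eq)
  define a b c d where "a = int i" and "b = int j - int i" and "c = int c'" and "d = int d'"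
  have n: "n = (a, b, c, d)"
    by (simp add: n_def max a_def b_def c_def d_def)
  have "b = 0"
  proof (rule ccontr)
    assume "b \<noteq> 0"
    let ?e0 = "(0, -1, 0, 0) :: exponent" and ?e1 = "(1, -1, 0, 0) :: exponent"
    define \<kappa> where "\<kappa> = l powi - c * m powi - d * p powi a"
    \<comment> \<open>The conjugate of \<open>y\<close> by \<open>u\<close>; a combination of it with \<open>y\<close> is a multiple of \<open>x\<^sup>-\<^sup>1\<close>.\<close>
    define y' where "y' = single ?e1 (\<kappa> * p powi b / (p - 1)) - single ?e0 (\<kappa> / (p - 1))"
    obtain b' where b': "b' \<in> subalgebra" "mul u (torus_image Gen_y) = mul b' u"
      by (rule normal_conjugate[OF assms subalgebra_closed(2)])
    have "mul u (torus_image Gen_y) = mul y' u"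
      unfolding y'_def u_eq n torus_image_def gen.case mul_minus minus_mul mul_single_single
      by (intro arg_cong2[of _ _ _ _ "(-)"] arg_cong2[of _ _ _ _ single])
        (simp_all add: \<kappa>_def cocycle_eq power_int_minus mult_ac)
    then have "mul (b' - y') u = 0"
      using b'(2) by (simp add: minus_mul)
    then have "b' = y'"
      using mul_nonzero[of "b' - y'" u] u(2) by auto
    then have "(\<kappa> * p powi b) *\<^sub>P torus_image Gen_y - y' \<in> subalgebra"
      using b'(1) by (simp add: subalgebra_closed)
    moreover have "(\<kappa> * p powi b) *\<^sub>P torus_image Gen_y - y' = single ?e0 (\<kappa> * (1 - p powi b) / (p - 1))"
      by (simp add: y'_def torus_image_def scl_simps diff_divide_distrib right_diff_distrib single_diff)
    moreover have nz: "\<kappa> * (1 - p powi b) / (p - 1) \<noteq> 0"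
      using p_powi_inj[of b 0] \<open>b \<noteq> 0\<close> by (auto simp: \<kappa>_def)
    ultimately obtain i j c d where
      "Max (keys (single ?e0 (\<kappa> * (1 - p powi b) / (p - 1)))) = (int i, int j - int i, int c, int d)"
      using Max_keys_subalgebra single_eq_zero_iff by metis
    then show False
      using nz by (simp, linarith)
  qed
  then have "n \<in> normal_exponents"
    by (simp add: n normal_exponents_def a_def c_def d_def)
  then show ?thesis
    using that \<open>k \<noteq> 0\<close> u_eq by blast
qed

end

section \<open>Invariants of an isomorphism\<close>

text \<open>
  The two algebras are represented by their images in two quantum tori. The map \<open>\<psi>\<close> relates only these
  images; it need not extend to the tori, since \<open>x\<close> and \<open>y\<close> may be exchanged.
\<close>
locale quantum_weyl_isomorphism =
  A: quantum_weyl p1 l1 m1 q1 + B: quantum_weyl p2 l2 m2 q2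
  for p1 l1 m1 q1 p2 l2 m2 q2 :: "'k::field" +
  fixes \<psi> :: "(exponent \<Rightarrow>\<^sub>0 'k) \<Rightarrow> (exponent \<Rightarrow>\<^sub>0 'k)"
  assumes bij: "bij_betw \<psi> A.subalgebra B.subalgebra"
    and map_mul: "u \<in> A.subalgebra \<Longrightarrow> v \<in> A.subalgebra \<Longrightarrow> \<psi> (A.mul u v) = B.mul (\<psi> u) (\<psi> v)"
    and map_scl: "u \<in> A.subalgebra \<Longrightarrow> \<psi> (c *\<^sub>P u) = c *\<^sub>P \<psi> u"
    and map_one: "\<psi> 1 = 1"
begin

lemma map_in [simp]: "u \<in> A.subalgebra \<Longrightarrow> \<psi> u \<in> B.subalgebra"
  using bij by (auto simp: bij_betw_def)

lemma map_eq_iff: "u \<in> A.subalgebra \<Longrightarrow> v \<in> A.subalgebra \<Longrightarrow> \<psi> u = \<psi> v \<longleftrightarrow> u = v"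
  using bij by (auto simp: bij_betw_def dest: inj_onD)

lemma map_surj: "v \<in> B.subalgebra \<Longrightarrow> \<exists>u\<in>A.subalgebra. \<psi> u = v"
  using bij by (metis bij_betw_def image_iff)

lemma map_zero: "\<psi> 0 = 0"
  using map_scl[of 1 0] A.subalgebra_closed(1) by simp

lemma map_nonzero: "u \<in> A.subalgebra \<Longrightarrow> u \<noteq> 0 \<Longrightarrow> \<psi> u \<noteq> 0"
  using map_eq_iff[of u 0] A.subalgebra_closed(6)[OF A.subalgebra_closed(1), of 0] by (simp add: map_zero)

lemma inverse_isomorphism:
  "quantum_weyl_isomorphism p2 l2 m2 q2 p1 l1 m1 q1 (inv_into A.subalgebra \<psi>)"
proof -
  let ?\<phi> = "inv_into A.subalgebra \<psi>"
  have \<phi>: "?\<phi> v \<in> A.subalgebra" "\<psi> (?\<phi> v) = v" if "v \<in> B.subalgebra" for v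
    using that bij by (auto simp: bij_betw_def inv_into_into f_inv_into_f)
  have \<phi>_eq: "?\<phi> v = u" if "u \<in> A.subalgebra" "\<psi> u = v" for u v
    using that bij by (auto simp: bij_betw_def)
  show ?thesis
  proof
    show "bij_betw ?\<phi> B.subalgebra A.subalgebra"
      using bij by (rule bij_betw_inv_into)
  qed (auto intro!: \<phi>_eq simp: \<phi> map_mul map_scl map_one A.subalgebra_closed)
qed

lemma map_normal:
  assumes "A.normal u"
  shows "B.normal (\<psi> u)"
proof -
  have u: "u \<in> A.subalgebra" "u \<noteq> 0" and conj: "\<And>b. b \<in> A.subalgebra \<Longrightarrow> \<exists>b'\<in>A.subalgebra. A.mul u b = A.mul b' u"
    using assms by (auto simp: A.normal_def)
  have "\<exists>b'\<in>B.subalgebra. B.mul (\<psi> u) b = B.mul b' (\<psi> u)" if b: "b \<in> B.subalgebra" for b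
  proof -
    obtain c where c: "c \<in> A.subalgebra" "\<psi> c = b"
      using map_surj[OF b] by blast
    then obtain c' where "c' \<in> A.subalgebra" "A.mul u c = A.mul c' u"
      using conj by blast
    then show ?thesis
      using c u map_mul by (metis map_in)
  qed
  then show ?thesis
    using u by (simp add: B.normal_def map_nonzero)
qed

lemma normal_preimage:
  assumes "B.normal v"
  obtains u where "A.normal u" "\<psi> u = v"
proof -
  interpret inv: quantum_weyl_isomorphism p2 l2 m2 q2 p1 l1 m1 q1 "inv_into A.subalgebra \<psi>"
    by (rule inverse_isomorphism)
  have "v \<in> B.subalgebra"
    using assms by (simp add: B.normal_def)
  then have "\<psi> (inv_into A.subalgebra \<psi> v) = v"
    using bij by (auto simp: bij_betw_def f_inv_into_f)
  then show ?thesis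
    using inv.map_normal[OF assms] that by blast
qed

lemma map_scalar: "\<psi> (single 0 k) = single 0 k"
proof -
  have "single 0 k = k *\<^sub>P (1 :: exponent \<Rightarrow>\<^sub>0 'k)"
    by (metis scl_single single_one mult_1_right)
  then show ?thesis
    by (simp only: map_scl[OF A.subalgebra_closed(1)] map_one)
qed

text \<open>
  The image of \<open>z\<close>, \<open>s\<close> or \<open>t\<close> is a normal monomial. If its exponent were decomposable, the two factors would have normal, hence
  monomial, preimages whose product is the generator; one of them would be a scalar, and so would its image.
\<close>
lemma map_generator:
  assumes "e \<in> {exp_z, exp_s, exp_t}"
  obtains e' k where "e' \<in> {exp_z, exp_s, exp_t}" "k \<noteq> 0" "\<psi> (single e 1) = single e' k"
proof -
  have e: "e \<in> normal_exponents"
    using assms by auto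
  obtain n k where n: "n \<in> normal_exponents" and k: "k \<noteq> 0" and eq: "\<psi> (single e 1) = single n k"
    using B.normal_imp_monomial[OF map_normal[OF A.monomial_normal[OF e one_neq_zero]]] by blast
  have "n \<noteq> 0"
  proof
    assume "n = 0"
    then have "\<psi> (single e 1) = \<psi> (single 0 k)"
      using eq by (simp only: map_scalar)
    moreover have "(0::exponent) \<in> normal_exponents"
      by (simp add: normal_exponents_def zero_prod_def)
    ultimately have eq: "single e 1 = single 0 k"
      using A.monomial_in_subalgebra e map_eq_iff by blast
    have "e = 0"
      using arg_cong[OF eq, of keys] k by simp
    then show False
      using assms by (auto simp: zero_prod_def)
  qed
  have "n \<in> {exp_z, exp_s, exp_t}"
  proof (rule ccontr)
    assume "n \<notin> {exp_z, exp_s, exp_t}"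
    then obtain f g where f: "f \<in> normal_exponents" "f \<noteq> 0" and g: "g \<in> normal_exponents" "g \<noteq> 0"
      and fg: "n = f + g"
      using normal_exponents_decompose n \<open>n \<noteq> 0\<close> by metis
    let ?c = "k / B.cocycle f g"
    obtain u where u: "A.normal u" "\<psi> u = single f 1"
      using normal_preimage[OF B.monomial_normal[OF f(1) one_neq_zero]] by blast
    have "?c \<noteq> 0"
      using k by simp
    obtain v where v: "A.normal v" "\<psi> v = single g ?c"
      using normal_preimage[OF B.monomial_normal[OF g(1) \<open>?c \<noteq> 0\<close>]] by blast
    have in_sub: "u \<in> A.subalgebra" "v \<in> A.subalgebra"
      using u(1) v(1) by (auto simp: A.normal_def)
    have "\<psi> (A.mul u v) = \<psi> (single e 1)"
      by (simp add: map_mul in_sub u(2) v(2) eq fg)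
    then have uv: "A.mul u v = single e 1"
      using map_eq_iff A.monomial_in_subalgebra[OF e] A.subalgebra_closed(5) in_sub by blast
    obtain f' k' where f': "f' \<in> normal_exponents" "k' \<noteq> 0" "u = single f' k'"
      using A.normal_imp_monomial[OF u(1)] by blast
    obtain g' k'' where g': "g' \<in> normal_exponents" "k'' \<noteq> 0" "v = single g' k''"
      using A.normal_imp_monomial[OF v(1)] by blast
    have "f' + g' = e"
      using arg_cong[OF uv, of keys] f'(2) g'(2) by (simp add: f'(3) g'(3))
    then have "f' = 0 \<or> g' = 0"
      using normal_exponents_indecomposable[OF f'(1) g'(1)] assms by simp
    then show False
    proof
      assume "f' = 0"
      then have "single 0 k' = single f 1"
        using u(2) f'(3) by (simp only: map_scalar)
      from arg_cong[OF this, of keys] show False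
        using f'(2) f(2) by simp
    next
      assume "g' = 0"
      then have "single 0 k'' = single g ?c"
        using v(2) g'(3) by (simp only: map_scalar)
      from arg_cong[OF this, of keys] show False
        using g'(2) g(2) \<open>?c \<noteq> 0\<close> by simp
    qed
  qed
  then show ?thesis
    using that k eq by blast
qed

text \<open>
  Commutation factors with \<open>z\<close>, \<open>s\<close>, \<open>t\<close> can be read off at any exponent of the image.
\<close>
lemma map_commute:
  assumes "u \<in> A.subalgebra" "single e 1 \<in> A.subalgebra"
    and "\<psi> (single e 1) = single e' k" "k \<noteq> 0"
    and "A.mul u (single e 1) = A.mul (single e c) u" "n \<in> keys (\<psi> u)"
  shows "B.cocycle n e' = c * B.cocycle e' n"
proof -
  have "single e c = c *\<^sub>P single e 1"
    by simp
  then have "\<psi> (single e c) = single e' (c * k)"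
    using map_scl[OF assms(2), of c] assms(3) by simp
  moreover have "single e c \<in> A.subalgebra"
    using A.subalgebra_closed(6)[OF assms(2), of c] by simp
  ultimately have "B.mul (\<psi> u) (single e' k) = B.mul (single e' (c * k)) (\<psi> u)"
    using assms by (metis map_mul)
  moreover have "single e' k = k *\<^sub>P single e' 1" "single e' (c * k) = k *\<^sub>P single e' c"
    by (simp_all add: mult.commute)
  ultimately have "k *\<^sub>P B.mul (\<psi> u) (single e' 1) = k *\<^sub>P B.mul (single e' c) (\<psi> u)"
    by (simp only: B.mul_scl B.scl_mul)
  then have "B.mul (\<psi> u) (single e' 1) = B.mul (single e' c) (\<psi> u)"
    by (rule scl_cancel[OF \<open>k \<noteq> 0\<close>])
  then show ?thesis
    using assms(6) by (simp add: B.commute_monomial_iff)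
qed

text \<open>
  The leading exponents of the images of \<open>x\<close> and \<open>y\<close> have opposite \<open>x\<close>-degrees \<open>b\<close> and \<open>- b\<close>. If \<open>s\<close> and \<open>t\<close> are
  kept, \<open>x\<close> gives \<open>\<lambda>\<^sub>1 = \<lambda>\<^sub>2\<^sup>b q\<^sub>2\<^sup>d\<close> and \<open>y\<close> gives \<open>\<lambda>\<^sub>1 q\<^sub>2\<^sup>d\<^sup>' = \<lambda>\<^sub>2\<^sup>b\<close>, where \<open>d, d' \<ge> 0\<close> are exponents
  of \<open>t\<close>; this forces \<open>d = d' = 0\<close>. The other parameter and the interchanged case are analogous.
\<close>
lemma parameters_determined:
  obtains b where "p1 = p2 powi b"
    "q1 = q2 \<and> l1 = l2 powi b \<and> m1 = m2 powi b \<or> q1 = inverse q2 \<and> l1 = m2 powi b \<and> m1 = l2 powi b"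
proof -
  have sub: "single e 1 \<in> A.subalgebra" if "e \<in> {exp_z, exp_s, exp_t}" for e
    using that by (auto intro: A.monomial_in_subalgebra)
  have generator: "\<exists>e' k. e' \<in> {exp_z, exp_s, exp_t} \<and> k \<noteq> 0 \<and> \<psi> (single e 1) = single e' k"
    if "e \<in> {exp_z, exp_s, exp_t}" for e
    using map_generator[OF that] by blast
  obtain z kz where z: "z \<in> {exp_z, exp_s, exp_t}" "kz \<noteq> 0" "\<psi> (single exp_z 1) = single z kz"
    using generator[of exp_z] by blast
  obtain s ks where s: "s \<in> {exp_z, exp_s, exp_t}" "ks \<noteq> 0" "\<psi> (single exp_s 1) = single s ks"
    using generator[of exp_s] by blast
  obtain t kt where t: "t \<in> {exp_z, exp_s, exp_t}" "kt \<noteq> 0" "\<psi> (single exp_t 1) = single t kt"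
    using generator[of exp_t] by blast
  have zs: "B.cocycle z s = B.cocycle s z"
    using map_commute[OF sub sub s(3,2), of exp_z 1 z] z by (simp add: A.cocycle_eq)
  have zt: "B.cocycle z t = B.cocycle t z"
    using map_commute[OF sub sub t(3,2), of exp_z 1 z] z by (simp add: A.cocycle_eq)
  have st: "B.cocycle s t = q1 * B.cocycle t s"
    using map_commute[OF sub sub t(3,2), of exp_s q1 s] s by (simp add: A.cocycle_eq power_int_minus)
  have "q1 \<noteq> 1" "q2 \<noteq> 1"
    using A.q_not_root_of_unity B.q_not_root_of_unity by (auto simp: root_of_unity_def)
  then have cases: "z = exp_z \<and> (s = exp_s \<and> t = exp_t \<and> q1 = q2 \<or> s = exp_t \<and> t = exp_s \<and> q1 = inverse q2)"
    using z(1) s(1) t(1) zs zt st by (auto simp: B.cocycle_eq power_int_minus field_simps)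
  let ?X = "\<psi> (A.torus_image Gen_x)" and ?Y = "\<psi> (A.torus_image Gen_y)"
  have "?X \<in> B.subalgebra" "?X \<noteq> 0" "?Y \<in> B.subalgebra" "?Y \<noteq> 0"
    by (rule map_in map_nonzero A.subalgebra_closed A.torus_image_nonzero)+
  note X = this(1,2) and Y = this(3,4)
  obtain i j c d where MX: "Max (keys ?X) = (int i, int j - int i, int c, int d)"
    using X by (rule B.Max_keys_subalgebra)
  obtain i' j' c' d' where MY: "Max (keys ?Y) = (int i', int j' - int i', int c', int d')"
    using Y by (rule B.Max_keys_subalgebra)
  define b b' where "b = int j - int i" and "b' = int j' - int i'"
  note x_in = B.Max_keys_in[OF X(2), unfolded MX, folded b_def]
    and y_in = B.Max_keys_in[OF Y(2), unfolded MY, folded b'_def]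
  note x = map_commute[OF A.subalgebra_closed(2) sub _ _ _ x_in]
    and y = map_commute[OF A.subalgebra_closed(2) sub _ _ _ y_in]
  have xz: "B.cocycle (int i, b, int c, int d) z = p1 * B.cocycle z (int i, b, int c, int d)"
    and xs: "B.cocycle (int i, b, int c, int d) s = inverse l1 * B.cocycle s (int i, b, int c, int d)"
    and xt: "B.cocycle (int i, b, int c, int d) t = inverse m1 * B.cocycle t (int i, b, int c, int d)"
    by (rule x[OF _ z(3,2)] x[OF _ s(3,2)] x[OF _ t(3,2)]; simp add: A.cocycle_eq)+
  have yz: "B.cocycle (int i', b', int c', int d') z = inverse p1 * B.cocycle z (int i', b', int c', int d')"
    and ys: "B.cocycle (int i', b', int c', int d') s = l1 * B.cocycle s (int i', b', int c', int d')"
    and yt: "B.cocycle (int i', b', int c', int d') t = m1 * B.cocycle t (int i', b', int c', int d')"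
    by (rule y[OF _ z(3,2)] y[OF _ s(3,2)] y[OF _ t(3,2)];
      simp add: A.torus_image_def A.mul_minus A.minus_mul A.cocycle_eq power_int_minus)+
  have p1: "p1 = p2 powi b"
    using xz cases by (simp add: B.cocycle_eq)
  have "p2 powi (- b) = p2 powi b'"
    using yz cases p1 by (simp add: B.cocycle_eq power_int_minus)
  then have b': "b' = - b"
    by (simp only: B.p_powi_inj)
  have balance: "X = R" if "X = R * q2 powi int n" "X * q2 powi int n' = R" "R \<noteq> 0" for X R :: 'k and n n'
  proof -
    have "R * q2 powi (int n + int n') = R * q2 powi 0"
      using that by (simp add: power_int_add mult.assoc del: B.q_powi_inj)
    then have "int n + int n' = 0"
      using \<open>R \<noteq> 0\<close> by (simp only: mult_cancel_left B.q_powi_inj simp_thms)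
    then have "n = 0"
      by simp
    then show ?thesis
      using that(1) by simp
  qed
  show ?thesis
  proof (cases "s = exp_s")
    case True
    have "l1 = l2 powi b"
      by (rule balance[of _ _ d d'])
        (use xs ys True b' in \<open>simp_all add: B.cocycle_eq power_int_minus field_simps\<close>)
    moreover have "m1 = m2 powi b"
      by (rule balance[of _ _ c' c])
        (use xt yt True cases b' in \<open>simp_all add: B.cocycle_eq power_int_minus field_simps\<close>)
    ultimately show ?thesis
      using that[OF p1] cases True by simp
  next
    case False
    have "l1 = m2 powi b"
      by (rule balance[of _ _ c' c])
        (use xs ys False cases b' in \<open>simp_all add: B.cocycle_eq power_int_minus field_simps\<close>)
    moreover have "m1 = l2 powi b"
      by (rule balance[of _ _ d d'])
        (use xt yt False cases b' in \<open>simp_all add: B.cocycle_eq power_int_minus field_simps\<close>)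
    ultimately show ?thesis
      using that[OF p1] cases False by simp
  qed
qed

end

section \<open>The classification\<close>

text \<open>
  Both algebras embed into their tori, so an isomorphism between them can be read as one between the images.
\<close>
lemma torus_isomorphism:
  assumes "quantum_weyl p1 l1 m1 q1" "quantum_weyl p2 l2 m2 q2"
    and iso: "algebra_isomorphic (quantum_weyl_extension p1 l1 m1 q1) (quantum_weyl_extension p2 l2 m2 q2)"
  obtains \<psi> where "quantum_weyl_isomorphism p1 l1 m1 q1 p2 l2 m2 q2 \<psi>"
proof -
  interpret A: quantum_weyl p1 l1 m1 q1 by fact
  interpret B: quantum_weyl p2 l2 m2 q2 by fact
  let ?I = "generated_ideal A.relations" and ?J = "generated_ideal B.relations"
  let ?A = "quotient_algebra free_algebra ?I" and ?B = "quotient_algebra free_algebra ?J"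
  note I = ideal_generated[of A.relations] and J = ideal_generated[of B.relations]
  note quotients = quotient_algebra_simps[OF I] quotient_algebra_simps[OF J]
  obtain h where h: "h \<in> ring_iso ?A ?B"
    and h_scl: "\<And>c X. X \<in> carrier ?A \<Longrightarrow> h (c \<odot>\<^bsub>?A\<^esub> X) = c \<odot>\<^bsub>?B\<^esub> h X"
    using iso unfolding algebra_isomorphic_def quantum_weyl_extension_def presented_algebra_def by blast
  have h_bij: "bij_betw h (range (coset ?I)) (range (coset ?J))"
    using ring_iso_memE(5)[OF h] by (simp add: quotients)
  have "\<exists>g. h (coset ?I f) = coset ?J g" for f
    using bij_betw_apply[OF h_bij, of "coset ?I f"] by auto
  then obtain H where H: "\<And>f. h (coset ?I f) = coset ?J (H f)"
    by metis
  have embed_A: "A.embed f = A.embed g \<longleftrightarrow> coset ?I f = coset ?I g" for f g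
    using A.embed_eq_zero_iff[of "f - g"] by (simp add: coset_eq_iff[OF I] A.eval_hom)
  have embed_B: "B.embed f = B.embed g \<longleftrightarrow> coset ?J f = coset ?J g" for f g
    using B.embed_eq_zero_iff[of "f - g"] by (simp add: coset_eq_iff[OF J] B.eval_hom)
  define \<psi> where "\<psi> u = B.embed (H (SOME f. A.embed f = u))" for u
  have \<psi>: "\<psi> (A.embed f) = B.embed g" if "h (coset ?I f) = coset ?J g" for f g
  proof -
    have "A.embed (SOME f'. A.embed f' = A.embed f) = A.embed f"
      by (rule someI) (rule refl)
    then show ?thesis
      unfolding \<psi>_def embed_A embed_B using H that by metis
  qed
  note \<psi>_embed = \<psi>[OF H]
  have "quantum_weyl_isomorphism p1 l1 m1 q1 p2 l2 m2 q2 \<psi>"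
  proof
    have inj: "A.embed f = A.embed g" if "B.embed (H f) = B.embed (H g)" for f g
      using bij_betw_imp_inj_on[OF h_bij] that unfolding embed_A embed_B H[symmetric] by (auto dest: inj_onD)
    have surj: "\<exists>f. B.embed (H f) = B.embed g" for g
    proof -
      have "coset ?J g \<in> h ` range (coset ?I)"
        using bij_betw_imp_surj_on[OF h_bij] by blast
      then show ?thesis
        using H embed_B by (metis (no_types) imageE)
    qed
    show "bij_betw \<psi> A.subalgebra B.subalgebra"
      unfolding bij_betw_def A.subalgebra_def B.subalgebra_def
      using surj by (auto intro!: inj_onI simp: \<psi>_embed image_iff dest: inj) metis
    show "\<psi> (A.mul u v) = B.mul (\<psi> u) (\<psi> v)" if uv: "u \<in> A.subalgebra" "v \<in> A.subalgebra" for u v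
    proof -
      obtain f g where fg: "u = A.embed f" "v = A.embed g"
        using uv by (auto simp: A.subalgebra_def)
      have "h (coset ?I (f * g)) = coset ?J (H f * H g)"
        using ring_iso_memE(2)[OF h, of "coset ?I f" "coset ?I g"] by (simp add: quotients H)
      then show ?thesis
        using \<psi> by (simp add: fg \<psi>_embed B.eval_hom flip: A.eval_mult)
    qed
    show "\<psi> (c *\<^sub>P u) = c *\<^sub>P \<psi> u" if u: "u \<in> A.subalgebra" for c u
    proof -
      obtain f where f: "u = A.embed f"
        using u by (auto simp: A.subalgebra_def)
      have "h (coset ?I (c *\<^sub>P f)) = coset ?J (c *\<^sub>P H f)"
        using h_scl[of "coset ?I f" c] by (simp add: quotients H)
      then show ?thesis
        using \<psi> by (simp add: f \<psi>_embed B.eval_hom flip: A.eval_scl)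
    qed
    have "h (coset ?I 1) = coset ?J 1"
      using ring_iso_memE(4)[OF h] by (simp add: quotients)
    then show "\<psi> 1 = 1"
      using \<psi>[of 1 1] by simp
  qed
  then show ?thesis
    by (rule that)
qed

lemma eval_relations_subset:
  fixes v :: "gen \<Rightarrow> ('h, 'k::field) free_alg"
  assumes "v Gen_x * v Gen_y - p *\<^sub>P (v Gen_y * v Gen_x) - 1 \<in> I"
    and "v Gen_s * v Gen_t - q *\<^sub>P (v Gen_t * v Gen_s) \<in> I"
    and "v Gen_s * v Gen_x - l *\<^sub>P (v Gen_x * v Gen_s) \<in> I"
    and "v Gen_s * v Gen_y - inverse l *\<^sub>P (v Gen_y * v Gen_s) \<in> I"
    and "v Gen_t * v Gen_x - m *\<^sub>P (v Gen_x * v Gen_t) \<in> I"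
    and "v Gen_t * v Gen_y - inverse m *\<^sub>P (v Gen_y * v Gen_t) \<in> I"
  shows "free.eval v ` quantum_weyl_relations p l m q \<subseteq> I"
  using assms by (simp add: quantum_weyl_relations_def Let_def free.eval_hom)

lemma scaled_relations:
  fixes p l m q c :: "'k::field"
  defines "I \<equiv> generated_ideal (quantum_weyl_relations p l m q)"
  shows "c *\<^sub>P (var Gen_x * var Gen_y - p *\<^sub>P (var Gen_y * var Gen_x) - 1) \<in> I"
    "c *\<^sub>P (var Gen_s * var Gen_t - q *\<^sub>P (var Gen_t * var Gen_s)) \<in> I"
    "c *\<^sub>P (var Gen_s * var Gen_x - l *\<^sub>P (var Gen_x * var Gen_s)) \<in> I"
    "c *\<^sub>P (var Gen_s * var Gen_y - inverse l *\<^sub>P (var Gen_y * var Gen_s)) \<in> I"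
    "c *\<^sub>P (var Gen_t * var Gen_x - m *\<^sub>P (var Gen_x * var Gen_t)) \<in> I"
    "c *\<^sub>P (var Gen_t * var Gen_y - inverse m *\<^sub>P (var Gen_y * var Gen_t)) \<in> I"
  unfolding I_def
  by (rule ideal_scl[OF ideal_generated], rule generated_ideal_base,
      simp add: quantum_weyl_relations_def Let_def)+

text \<open>
  The substitution \<open>x \<mapsto> y\<close>, \<open>y \<mapsto> - p\<^sup>-\<^sup>1 x\<close> turns \<open>x y - p y x\<close> into \<open>x y - p\<^sup>-\<^sup>1 y x\<close>; the factor
  \<open>- p\<^sup>-\<^sup>1\<close> is forced by the constant term 1 of the relation.
\<close>
lemma isomorphic_swap_xy:
  fixes p :: "'k::field"
  assumes "p \<noteq> 0"
  shows "algebra_isomorphic (quantum_weyl_extension p l m q)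
    (quantum_weyl_extension (inverse p) (inverse l) (inverse m) q)"
proof -
  define v :: "gen \<Rightarrow> (gen, 'k) free_alg" where
    "v = case_gen (var Gen_y) (- inverse p *\<^sub>P var Gen_x) (var Gen_s) (var Gen_t)"
  define w :: "gen \<Rightarrow> (gen, 'k) free_alg" where
    "w = case_gen (- p *\<^sub>P var Gen_y) (var Gen_x) (var Gen_s) (var Gen_t)"
  note rels = scaled_relations[where p = "inverse p" and l = "inverse l" and m = "inverse m" and q = q]
  have "free.eval v ` quantum_weyl_relations p l m q
      \<subseteq> generated_ideal (quantum_weyl_relations (inverse p) (inverse l) (inverse m) q)"
    by (rule eval_relations_subset)
      (use rels(1-6)[of 1] rels(3-6)[of "- inverse p"] assms in
        \<open>simp_all add: v_def free.mul_scl free.scl_mul scl_simps algebra_simps\<close>)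
  moreover note rels = scaled_relations[where p = p and l = l and m = m and q = q]
  have "free.eval w ` quantum_weyl_relations (inverse p) (inverse l) (inverse m) q
      \<subseteq> generated_ideal (quantum_weyl_relations p l m q)"
    by (rule eval_relations_subset)
      (use rels(1-6)[of 1] rels(3-6)[of "- p"] assms in
        \<open>simp_all add: w_def free.mul_scl free.scl_mul scl_simps algebra_simps\<close>)
  moreover have "free.eval w (v g) = var g" "free.eval v (w g) = var g" for g
    using assms by (cases g; simp add: v_def w_def free.eval_hom scl_simps)+
  ultimately show ?thesis
    unfolding quantum_weyl_extension_def by (rule presented_algebra_isomorphicI)
qed

lemma isomorphic_swap_st:
  fixes q :: "'k::field"
  assumes "q \<noteq> 0"
  shows "algebra_isomorphic (quantum_weyl_extension p l m q) (quantum_weyl_extension p m l (inverse q))"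
proof -
  define v :: "gen \<Rightarrow> (gen, 'k) free_alg" where
    "v = case_gen (var Gen_x) (var Gen_y) (var Gen_t) (var Gen_s)"
  have subset: "free.eval v ` quantum_weyl_relations p l m q
      \<subseteq> generated_ideal (quantum_weyl_relations p m l (inverse q))" if "q \<noteq> 0" for l m q
    by (rule eval_relations_subset)
      (use scaled_relations[where p = p and l = m and m = l and q = "inverse q" and c = 1]
        scaled_relations(2)[where p = p and l = m and m = l and q = "inverse q" and c = "- q"] that in
        \<open>simp_all add: v_def scl_simps algebra_simps\<close>)
  have "free.eval v (v g) = var g" for g
    by (cases g) (simp_all add: v_def)
  moreover note subset[of q l m] subset[of "inverse q" m l]
  ultimately show ?thesis
    unfolding quantum_weyl_extension_def using assms by (intro presented_algebra_isomorphicI[of v _ _ v]) simp_all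
qed

lemma algebra_isomorphic_refl: "algebra_isomorphic A A"
  unfolding algebra_isomorphic_def by (rule bexI[OF _ ring_iso_set_refl]) simp

theorem theorem2p3:
  fixes p1 p2 q1 q2 lam1 lam2 mu1 mu2 :: "'k::field"
  assumes "p1 \<noteq> 0" "p2 \<noteq> 0" "q1 \<noteq> 0" "q2 \<noteq> 0"
    and "lam1 \<noteq> 0" "lam2 \<noteq> 0" "mu1 \<noteq> 0" "mu2 \<noteq> 0"
    and "\<not> root_of_unity p1" "\<not> root_of_unity p2"
    and "\<not> root_of_unity q1" "\<not> root_of_unity q2"
  shows "algebra_isomorphic (quantum_weyl_extension p1 lam1 mu1 q1) (quantum_weyl_extension p2 lam2 mu2 q2) \<longleftrightarrow>
    (p1 = p2 \<and> q1 = q2 \<and> lam1 = lam2 \<and> mu1 = mu2) \<or>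
    (p1 = inverse p2 \<and> q1 = q2 \<and> lam1 = inverse lam2 \<and> mu1 = inverse mu2) \<or>
    (p1 = p2 \<and> q1 = inverse q2 \<and> lam1 = mu2 \<and> lam2 = mu1) \<or>
    (p1 = inverse p2 \<and> q1 = inverse q2 \<and> lam1 = inverse mu2 \<and> lam2 = inverse mu1)"
    (is "?iso \<longleftrightarrow> ?cases")
proof
  assume ?iso
  have locales: "quantum_weyl p1 lam1 mu1 q1" "quantum_weyl p2 lam2 mu2 q2"
    using assms by (simp_all add: quantum_weyl_def)
  obtain \<psi> where "quantum_weyl_isomorphism p1 lam1 mu1 q1 p2 lam2 mu2 q2 \<psi>"
    using torus_isomorphism[OF locales \<open>?iso\<close>] by blast
  then interpret quantum_weyl_isomorphism p1 lam1 mu1 q1 p2 lam2 mu2 q2 \<psi> .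
  obtain b where b: "p1 = p2 powi b"
    "q1 = q2 \<and> lam1 = lam2 powi b \<and> mu1 = mu2 powi b \<or>
     q1 = inverse q2 \<and> lam1 = mu2 powi b \<and> mu1 = lam2 powi b"
    by (rule parameters_determined)
  obtain b' where "p2 = p1 powi b'"
    by (rule quantum_weyl_isomorphism.parameters_determined[OF inverse_isomorphism])
  then have "p2 powi (b * b') = p2 powi 1"
    by (simp only: b(1) power_int_mult power_int_1_right)
  then have "b * b' = 1"
    by (simp only: B.p_powi_inj)
  then have "b = 1 \<or> b = - 1"
    using zmult_eq_1_iff by blast
  then show ?cases
    using b by (auto simp: power_int_minus)
next
  have swap_both: "algebra_isomorphic (quantum_weyl_extension p1 lam1 mu1 q1)
      (quantum_weyl_extension (inverse p1) (inverse mu1) (inverse lam1) (inverse q1))"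
    using isomorphic_swap_xy[OF \<open>p1 \<noteq> 0\<close>] isomorphic_swap_st[OF \<open>q1 \<noteq> 0\<close>] by (rule algebra_isomorphic_trans)
  assume ?cases
  then show ?iso
    using algebra_isomorphic_refl isomorphic_swap_xy[OF \<open>p1 \<noteq> 0\<close>, of lam1 mu1 q1]
      isomorphic_swap_st[OF \<open>q1 \<noteq> 0\<close>, of p1 lam1 mu1] swap_both by auto
qed

end
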